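(* Let $S$ be an essential finite poset which is a union $S=S_1\cup S_2$, $S_1\cap S_2=\emptyset$, of two unitarily one-parameter posets $S_1$, $S_2$ (elements of $S_1$ are allowed to be comparable with elements of $S_2$). Then $S$ is (isomorphic to) one of the following seven posets, where in each case the order is generated by the listed relations and there are no other relations: (1) $\{g_1,g_2,g_3,g_4\}$ with no two distinct elements comparable; (2) $\{g_1,\dots,g_5\}$ with $g_1<g_5$, $g_2<g_5$; (3) $\{g_1,\dots,g_5\}$ with $g_5<g_1$, $g_5<g_2$; (4) $\{g_1,\dots,g_6\}$ with $g_1<g_5$, $g_2<g_5$, $g_5<g_6$; (5) $\{g_1,\dots,g_6\}$ with $g_6<g_5$, $g_5<g_1$, $g_5<g_2$; (6) $\{g_1,\dots,g_6\}$ with $g_1<g_5$, $g_2<g_5$, $g_3<g_6$, $g_4<g_6$; (7) $\{g_1,\dots,g_6\}$ with $g_5<g_1$, $g_5<g_2$, $g_6<g_3$, $g_6<g_4$.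
   Context: A finite poset $T$ is called unitarily one-parameter if it can be written as $T=T_1\cup\dots\cup T_m$ (disjoint), where the $T_i$ are totally ordered as blocks (for $i<j$, every element of $T_i$ is strictly less than every element of $T_j$), exactly one block $T_k$ consists of two incomparable elements, and every other block consists of a single element. The subsets $S_1,S_2$ of $S$ carry the order induced from $S$. A (Hilbert) representation of a finite poset $S$ on a complex Hilbert space $H\neq\{0\}$ is a family of orthogonal projections $P_g$, $g\in S$, in $H$ such that $P_gP_h=P_g$ whenever $g<h$. It is irreducible if the only closed subspaces of $H$ invariant under all $P_g$, $g\in S$, are $\{0\}$ and $H$. A character on $S$ is a function $S\ni g\mapsto\alpha_g>0$; the standing assumption is that $0<\alpha_g<1$ for all $g\in S$ and $\sum_{g\in S}\alpha_g>1$. A representation is orthoscalar with character $\alpha=(\alpha_g)_{g\in S}$ if $\sum_{g\in S}\alpha_gP_g=I$. A representation is orthoscalar if it is orthoscalar with some character. An orthoscalar representation $(P_g)_{g\in S}$ of $S$ is essential if $P_g\ne0$ and $P_g\ne I$ for all $g\in S$, and $P_g\ne P_h$ for all $g,h\in S$ with $g<h$. A poset $S$ is essential if it possesses an irreducible essential orthoscalar representation. *)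

theory Defs
  imports "HOL-Analysis.Analysis"
begin

section \<open>Complex Hilbert spaces\<close>

class complex_vector = real_vector +
  fixes scaleC :: "complex \<Rightarrow> 'a \<Rightarrow> 'a" (infixr "*\<^sub>C" 75)
  assumes scaleC_add_right: "a *\<^sub>C (x + y) = a *\<^sub>C x + a *\<^sub>C y"
    and scaleC_add_left: "(a + b) *\<^sub>C x = a *\<^sub>C x + b *\<^sub>C x"
    and scaleC_scaleC: "a *\<^sub>C (b *\<^sub>C x) = (a * b) *\<^sub>C x"
    and scaleC_one: "1 *\<^sub>C x = x"
    and scaleR_scaleC: "r *\<^sub>R x = complex_of_real r *\<^sub>C x"

text \<open>
  The complex inner product is antilinear in its first and linear in its second argument.
  Its real part is the real inner product, so positive definiteness, the norm
  \<open>norm x = sqrt (Re (cinner x x))\<close>, the topology and completeness come from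
  the classes \<^class>\<open>real_inner\<close> and \<^class>\<open>banach\<close>.
\<close>

class chilbert_space = complex_vector + banach + real_inner +
  fixes cinner :: "'a \<Rightarrow> 'a \<Rightarrow> complex"
  assumes cinner_commute: "cinner x y = cnj (cinner y x)"
    and cinner_add_right: "cinner x (y + z) = cinner x y + cinner x z"
    and cinner_scaleC_right: "cinner x (a *\<^sub>C y) = a * cinner x y"
    and inner_eq_Re_cinner: "inner x y = Re (cinner x y)"

definition csubspace :: "'h::complex_vector set \<Rightarrow> bool" where
  "csubspace M \<longleftrightarrow>
     0 \<in> M \<and> (\<forall>x\<in>M. \<forall>y\<in>M. x + y \<in> M) \<and> (\<forall>c. \<forall>x\<in>M. c *\<^sub>C x \<in> M)"

definition bounded_clinear :: "('h::chilbert_space \<Rightarrow> 'h) \<Rightarrow> bool" where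
  "bounded_clinear A \<longleftrightarrow> bounded_linear A \<and> (\<forall>c x. A (c *\<^sub>C x) = c *\<^sub>C A x)"

definition orthogonal_projection :: "('h::chilbert_space \<Rightarrow> 'h) \<Rightarrow> bool" where
  "orthogonal_projection P \<longleftrightarrow>
     bounded_clinear P \<and> P \<circ> P = P \<and> (\<forall>x y. cinner (P x) y = cinner x (P y))"

section \<open>Representations of posets\<close>

definition poset_representation ::
    "'a::order set \<Rightarrow> ('a \<Rightarrow> 'h::chilbert_space \<Rightarrow> 'h) \<Rightarrow> bool" where
  "poset_representation S P \<longleftrightarrow>
     (UNIV :: 'h set) \<noteq> {0} \<and>
     (\<forall>g\<in>S. orthogonal_projection (P g)) \<and>
     (\<forall>g\<in>S. \<forall>h\<in>S. g < h \<longrightarrow> P g \<circ> P h = P g)"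

definition irreducible_representation ::
    "'a::order set \<Rightarrow> ('a \<Rightarrow> 'h::chilbert_space \<Rightarrow> 'h) \<Rightarrow> bool" where
  "irreducible_representation S P \<longleftrightarrow>
     poset_representation S P \<and>
     (\<forall>M. csubspace M \<and> closed M \<and> (\<forall>g\<in>S. P g ` M \<subseteq> M) \<longrightarrow> M = {0} \<or> M = UNIV)"

text \<open>
  The bound \<open>\<alpha> g < 1\<close> and the condition on the sum are the standing
  assumptions on characters; they are part of the definition here.
\<close>

definition poset_character :: "'a::order set \<Rightarrow> ('a \<Rightarrow> real) \<Rightarrow> bool" where
  "poset_character S \<alpha> \<longleftrightarrow> (\<forall>g\<in>S. 0 < \<alpha> g \<and> \<alpha> g < 1) \<and> (\<Sum>g\<in>S. \<alpha> g) > 1"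

definition orthoscalar_with ::
    "'a::order set \<Rightarrow> ('a \<Rightarrow> real) \<Rightarrow> ('a \<Rightarrow> 'h::chilbert_space \<Rightarrow> 'h) \<Rightarrow> bool" where
  "orthoscalar_with S \<alpha> P \<longleftrightarrow>
     poset_representation S P \<and> poset_character S \<alpha> \<and>
     (\<forall>x. (\<Sum>g\<in>S. \<alpha> g *\<^sub>R P g x) = x)"

definition orthoscalar ::
    "'a::order set \<Rightarrow> ('a \<Rightarrow> 'h::chilbert_space \<Rightarrow> 'h) \<Rightarrow> bool" where
  "orthoscalar S P \<longleftrightarrow> (\<exists>\<alpha>. orthoscalar_with S \<alpha> P)"

definition essential_representation ::
    "'a::order set \<Rightarrow> ('a \<Rightarrow> 'h::chilbert_space \<Rightarrow> 'h) \<Rightarrow> bool" where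
  "essential_representation S P \<longleftrightarrow>
     orthoscalar S P \<and>
     (\<forall>g\<in>S. P g \<noteq> (\<lambda>x. 0) \<and> P g \<noteq> id) \<and>
     (\<forall>g\<in>S. \<forall>h\<in>S. g < h \<longrightarrow> P g \<noteq> P h)"

text \<open>
  A formula cannot quantify over the Hilbert space, which is a type; so the space is
  a parameter. A theorem with this predicate as an assumption and the type variable
  \<open>'h\<close> free holds for every Hilbert space.
\<close>

definition essential_poset :: "'h::chilbert_space itself \<Rightarrow> 'a::order set \<Rightarrow> bool" where
  "essential_poset (_ :: 'h itself) S \<longleftrightarrow>
     (\<exists>P :: 'a \<Rightarrow> 'h \<Rightarrow> 'h. irreducible_representation S P \<and> essential_representation S P)"

section \<open>Classes of posets\<close>

definition unitarily_one_parameter :: "'a::order set \<Rightarrow> bool" where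
  "unitarily_one_parameter T \<longleftrightarrow>
     (\<exists>(m::nat) (B :: nat \<Rightarrow> 'a set).
        T = (\<Union>i\<in>{1..m}. B i) \<and> disjoint_family_on B {1..m} \<and>
        (\<forall>i\<in>{1..m}. \<forall>j\<in>{1..m}. i < j \<longrightarrow> (\<forall>x\<in>B i. \<forall>y\<in>B j. x < y)) \<and>
        (\<exists>k\<in>{1..m}.
           (\<exists>x y. B k = {x, y} \<and> \<not> x \<le> y \<and> \<not> y \<le> x) \<and>
           (\<forall>i\<in>{1..m} - {k}. \<exists>x. B i = {x})))"

text \<open>
  \<open>S\<close> is isomorphic to the poset on \<open>g\<^sub>1, \<dots>, g\<^sub>n\<close> whose order is the
  reflexive transitive closure of \<open>R\<close>, where \<open>(i, j) \<in> R\<close> stands for the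
  relation \<open>g\<^sub>i < g\<^sub>j\<close>.
\<close>

definition isomorphic_to_generated_poset ::
    "'a::order set \<Rightarrow> nat \<Rightarrow> (nat \<times> nat) set \<Rightarrow> bool" where
  "isomorphic_to_generated_poset S n R \<longleftrightarrow>
     (\<exists>g. bij_betw g {1..n} S \<and>
          (\<forall>i\<in>{1..n}. \<forall>j\<in>{1..n}. g i \<le> g j \<longleftrightarrow> (i, j) \<in> R\<^sup>*))"

end

theory Submission
  imports Defs
begin

text \<open>
  Let \<open>A\<close> be the sum of the \<open>\<alpha> g *\<^sub>R P g\<close> over \<open>S1\<close>; orthoscalarity says that the sum
  over \<open>S2\<close> is \<open>I - A\<close>. Everything is read off from the eigenspaces of \<open>A\<close>.

  Let \<open>V\<close> be such a sum over a chain of singletons followed by a pair \<open>x\<close>, \<open>y\<close> above them,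
  and put \<open>t = \<alpha> x + \<alpha> y\<close>. Then \<open>V\<^sup>2 - t V\<close> commutes with all projections of that chain
  and pair (\<open>chain_below_pair_reflecting\<close>). So these projections move an eigenvector of \<open>V\<close> for
  \<open>\<kappa>\<close> only into the eigenspaces of \<open>\<kappa>\<close> and of its reflection \<open>t - \<kappa>\<close>. Applied to both parts
  this gives two reflections of the eigenvalues of \<open>A\<close>. In an irreducible family, a set of reals that
  contains some eigenvalue, and the reflections of its members as far as these are eigenvalues, contains all
  eigenvalues (\<open>eigenvalues_connected\<close>): they form a single path whose steps are alternately the two
  reflections. No spectral theorem is involved, and the Hilbert space may have any dimension.

  A singleton below its pair produces an eigenvalue of \<open>V\<close> larger than \<open>t\<close>. Its reflection is negative,
  hence not an eigenvalue, so it is an end of the path. Different singletons give different ends, and a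
  path has at most two (\<open>card_chains_le_2\<close>). This bounds the number of singletons when all of them lie
  below the pairs. Replacing each \<open>P g\<close> by \<open>I - P g\<close> reverses the order and gives the case in which
  all of them lie above.

  The mixed cases do not occur. The sum over a part with a singleton below its pair attains the total
  weight of that part, and the sum over a part with a singleton above its pair attains \<open>0\<close>. Comparing
  such extreme values for \<open>A\<close> and \<open>I - A\<close> yields a common eigenvector of all projections or forces
  two projections to coincide (\<open>no_least_and_greatest_across\<close>,
  \<open>no_least_and_greatest_beside_pair\<close>).

  Finally, a relation \<open>g < h\<close> between elements of different parts makes some nonzero subspace of the
  range of a single \<open>P s \<noteq> I\<close> invariant under the whole family or, if there are no singletons, forces
  three eigenvalues where a reflection leaves room for two (\<open>no_relation_across\<close>). What remains is two
  incomparable pairs, each with a chain on the same side, and at most two elements in both chains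
  together: these are the seven posets.
\<close>

section \<open>Orthogonal projections\<close>

lemma inner_scaleC_left: "inner (a *\<^sub>C x) y = inner x (cnj a *\<^sub>C y)"
  for x y :: "'h::chilbert_space"
proof -
  have "cinner (a *\<^sub>C x) y = cnj a * cinner x y"
    by (metis cinner_commute cinner_scaleC_right complex_cnj_mult)
  then show ?thesis
    by (simp add: inner_eq_Re_cinner cinner_scaleC_right)
qed

lemma scaleC_zero_right: "c *\<^sub>C (0 :: 'h::complex_vector) = 0"
  using scaleC_add_right[of c "0::'h" 0] by simp

lemma scaleR_scaleC_commute: "r *\<^sub>R (c *\<^sub>C x) = c *\<^sub>C (r *\<^sub>R x)"
  by (simp add: scaleR_scaleC scaleC_scaleC mult.commute)

lemma scaleC_sum: "c *\<^sub>C (\<Sum>i\<in>I. f i) = (\<Sum>i\<in>I. c *\<^sub>C f i)"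
  by (induction I rule: infinite_finite_induct) (auto simp: scaleC_zero_right scaleC_add_right)

text \<open>
  For orthogonal projections this is the inclusion of ranges. Stating comparabilities through operators
  keeps the arguments below independent of the poset, so that they apply to the complements as well.
\<close>

definition proj_le :: "('h \<Rightarrow> 'h) \<Rightarrow> ('h \<Rightarrow> 'h) \<Rightarrow> bool" where
  "proj_le p q \<longleftrightarrow> p \<circ> q = p"

lemma orthogonal_projectionD:
  assumes "orthogonal_projection p"
  shows "linear p" "p (p x) = p x" "inner (p x) y = inner x (p y)" "p (c *\<^sub>C x) = c *\<^sub>C p x"
  using assms unfolding orthogonal_projection_def bounded_clinear_def inner_eq_Re_cinner
  by (auto simp: fun_eq_iff bounded_linear.linear)

lemma orthogonal_projection_complement:
  assumes "orthogonal_projection p"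
  shows "orthogonal_projection (\<lambda>x. x - p x)"
proof -
  have p: "bounded_linear p" "p \<circ> p = p" "\<And>x y. cinner (p x) y = cinner x (p y)"
      "\<And>c x. p (c *\<^sub>C x) = c *\<^sub>C p x"
    using assms by (auto simp: orthogonal_projection_def bounded_clinear_def)
  have diff_right: "cinner x (y - z) = cinner x y - cinner x z" for x y z :: 'a
    by (metis add_diff_cancel_right' cinner_add_right diff_add_cancel)
  have diff_left: "cinner (x - y) z = cinner x z - cinner y z" for x y z :: 'a
    by (metis cinner_commute complex_cnj_diff diff_right)
  have scaleC_diff: "c *\<^sub>C (x - y) = c *\<^sub>C x - c *\<^sub>C y" for c and x y :: 'a
    by (metis add_diff_cancel_right' diff_add_cancel scaleC_add_right)
  have "bounded_linear (\<lambda>x. x - p x)"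
    by (intro bounded_linear_sub bounded_linear_ident p(1))
  moreover have "(\<lambda>x. x - p x) \<circ> (\<lambda>x. x - p x) = (\<lambda>x. x - p x)"
    using p(2) by (auto simp: fun_eq_iff linear_diff[OF bounded_linear.linear[OF p(1)]])
  ultimately show ?thesis
    by (auto simp: orthogonal_projection_def bounded_clinear_def p diff_right diff_left scaleC_diff)
qed

lemma proj_le_refl: "orthogonal_projection p \<Longrightarrow> proj_le p p"
  by (auto simp: proj_le_def orthogonal_projection_def)

lemma proj_leD: "proj_le p q \<Longrightarrow> p (q x) = p x"
  by (auto simp: proj_le_def fun_eq_iff)

text \<open>
  The mirror image \<open>q \<circ> p = p\<close> of \<open>p \<circ> q = p\<close>, obtained by taking adjoints.
\<close>

lemma proj_leD':
  assumes "orthogonal_projection p" "orthogonal_projection q" "proj_le p q"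
  shows "q (p x) = p x"
proof -
  have "inner (q (p x) - p x) z = 0" for z
    using proj_leD[OF assms(3)]
    by (simp add: inner_diff_left orthogonal_projectionD(3)[OF assms(1)]
        orthogonal_projectionD(3)[OF assms(2)])
  from this[of "q (p x) - p x"] show ?thesis
    by simp
qed

lemma proj_le_trans: "proj_le p q \<Longrightarrow> proj_le q r \<Longrightarrow> proj_le p r"
  by (metis proj_le_def comp_assoc)

lemma proj_le_antisym:
  assumes "orthogonal_projection p" "orthogonal_projection q" "proj_le p q" "proj_le q p"
  shows "p = q"
  using proj_leD[OF assms(3)] proj_leD'[OF assms(2,1,4)] by (auto simp: fun_eq_iff)

lemma proj_le_complement:
  assumes "orthogonal_projection p" "orthogonal_projection q" "proj_le p q"
  shows "proj_le (\<lambda>x. x - q x) (\<lambda>x. x - p x)"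
  using proj_leD'[OF assms]
  by (auto simp: proj_le_def fun_eq_iff linear_diff[OF orthogonal_projectionD(1)[OF assms(2)]])

section \<open>Finite chains and paths of reflections\<close>

text \<open>
  Used for the order of a poset, for the inclusion of ranges, and for the converses of both; therefore the
  relation is arbitrary and only transitive and total on the set.
\<close>

lemma finite_total_has_greatest:
  assumes "finite C" "C \<noteq> {}"
    and "\<And>c d. c \<in> C \<Longrightarrow> d \<in> C \<Longrightarrow> r c d \<or> r d c"
    and "\<And>c d e. c \<in> C \<Longrightarrow> d \<in> C \<Longrightarrow> e \<in> C \<Longrightarrow> r c d \<Longrightarrow> r d e \<Longrightarrow> r c e"
  shows "\<exists>m\<in>C. \<forall>c\<in>C. r c m"
  using assms
proof (induction C rule: finite_ne_induct)
  case (singleton a)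
  show ?case using singleton.prems(1)[of a a] by simp
next
  case (insert a C)
  have "\<exists>m\<in>C. \<forall>c\<in>C. r c m"
  proof (rule insert.IH)
    show "r c d \<or> r d c" if "c \<in> C" "d \<in> C" for c d
      using insert.prems(1)[of c d] that by simp
    show "r c e" if "c \<in> C" "d \<in> C" "e \<in> C" "r c d" "r d e" for c d e
      using insert.prems(2)[of c d e] that by simp
  qed
  then obtain m where m: "m \<in> C" "\<And>c. c \<in> C \<Longrightarrow> r c m" by blast
  have a: "r a a" using insert.prems(1)[of a a] by simp
  show ?case
  proof (cases "r m a")
    case True
    have "r c a" if "c \<in> C" for c
      using insert.prems(2)[of c m a] m True that by simp
    then show ?thesis using a by simp
  next
    case False
    then have "r a m" using insert.prems(1)[of a m] m by simp
    then show ?thesis using m by auto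
  qed
qed

text \<open>
  Two involutions turn \<open>V\<close> into a graph in which a vertex has at most one neighbour for each
  of them. If the graph is connected it is a finite or infinite path or a cycle, so at most two of the involutions at its
  vertices lead out of \<open>V\<close>. An end is a pair of a vertex and an involution leading out there: a vertex
  from which both lead out counts twice, which is why its two roles need not be told apart later.

  The proof follows the path from one end, applying the two involutions in turn. Every vertex is met before
  the walk first leaves \<open>V\<close>, so the only other end is the place where this happens.
\<close>

lemma at_most_two_ends:
  fixes \<sigma> :: "bool \<Rightarrow> 'r \<Rightarrow> 'r" and V :: "'r set"
  assumes involution: "\<And>i z. \<sigma> i (\<sigma> i z) = z"
    and connected: "\<And>L. L \<subseteq> V \<Longrightarrow> L \<noteq> {} \<Longrightarrow> (\<And>i z. z \<in> L \<Longrightarrow> \<sigma> i z \<in> V \<Longrightarrow> \<sigma> i z \<in> L) \<Longrightarrow> L = V"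
  shows "\<exists>p q. {(i, z). z \<in> V \<and> \<sigma> i z \<notin> V} \<subseteq> {p, q}"
proof (cases "{(i, z). z \<in> V \<and> \<sigma> i z \<notin> V} = {}")
  case True
  then show ?thesis by (metis empty_subsetI)
next
  case False
  then obtain i0 e where e: "e \<in> V" "\<sigma> i0 e \<notin> V" by auto
  \<comment> \<open>At the first end the involution \<open>i0\<close> leads out, so the walk starts with the other one.\<close>
  define dir where "dir k = (if even k then \<not> i0 else i0)" for k :: nat
  define f where "f = rec_nat e (\<lambda>k. \<sigma> (dir k))"
  have f0: "f 0 = e" and fSuc: "f (Suc k) = \<sigma> (dir k) (f k)" for k
    by (simp_all add: f_def)
  define good where "good k \<longleftrightarrow> (\<forall>j\<le>k. f j \<in> V)" for k
  have step: "i = dir k \<or> (i = i0 \<and> k = 0) \<or> (\<exists>j. k = Suc j \<and> \<sigma> i (f k) = f j)" for i k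
  proof (cases "i = dir k")
    case False
    then show ?thesis
      by (cases k) (auto simp: dir_def fSuc involution split: if_splits)
  qed simp
  define L where "L = f ` Collect good"
  have L: "L = V"
  proof (rule connected)
    show "L \<subseteq> V" by (auto simp: L_def good_def)
    have "good 0" by (simp add: good_def f0 e)
    then show "L \<noteq> {}" by (auto simp: L_def)
    show "\<sigma> i z \<in> L" if z: "z \<in> L" "\<sigma> i z \<in> V" for i z
    proof -
      obtain k where k: "z = f k" "good k" using z by (auto simp: L_def)
      consider "i = dir k" | "i = i0" "k = 0" | j where "k = Suc j" "\<sigma> i (f k) = f j"
        using step by blast
      then show ?thesis
      proof cases
        case 1
        then have "good (Suc k)" using k z by (auto simp: good_def fSuc le_Suc_eq)
        then show ?thesis using 1 k by (auto simp: L_def fSuc[symmetric])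
      next
        case 2
        then show ?thesis using k z e by (simp add: f0)
      next
        case (3 j)
        then have "good j" using k by (simp add: good_def)
        then show ?thesis using 3 k by (simp add: L_def)
      qed
    qed
  qed
  have ends: "(i, z) = (i0, e) \<or> (\<exists>k. (i, z) = (dir k, f k) \<and> good k \<and> f (Suc k) \<notin> V)"
    if z: "z \<in> V" "\<sigma> i z \<notin> V" for i z
  proof -
    obtain k where k: "z = f k" "good k" using z L by (auto simp: L_def)
    consider "i = dir k" | "i = i0" "k = 0" | j where "k = Suc j" "\<sigma> i (f k) = f j"
      using step by blast
    then show ?thesis
    proof cases
      case 1
      then show ?thesis using k z by (auto simp: fSuc)
    next
      case 2
      then show ?thesis using k by (simp add: f0)
    next
      case (3 j)
      then show ?thesis using k z by (simp add: good_def)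
    qed
  qed
  have unique: "k = l" if "good k" "f (Suc k) \<notin> V" "good l" "f (Suc l) \<notin> V" for k l
    using that by (metis good_def nat_neq_iff Suc_leI)
  show ?thesis
  proof (cases "\<exists>k. good k \<and> f (Suc k) \<notin> V")
    case True
    then obtain k where "good k" "f (Suc k) \<notin> V" by blast
    then have "{(i, z). z \<in> V \<and> \<sigma> i z \<notin> V} \<subseteq> {(i0, e), (dir k, f k)}"
      using ends unique by blast
    then show ?thesis by blast
  next
    case False
    then have "{(i, z). z \<in> V \<and> \<sigma> i z \<notin> V} \<subseteq> {(i0, e), (i0, e)}"
      using ends by blast
    then show ?thesis by blast
  qed
qed

section \<open>Irreducible families of projections\<close>

text \<open>
  The projections of a unitarily one-parameter poset without singletons above its pair; the order enters
  only as inclusion of ranges.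
\<close>

definition chain_below_pair :: "('a \<Rightarrow> 'h \<Rightarrow> 'h) \<Rightarrow> 'a set \<Rightarrow> 'a \<Rightarrow> 'a \<Rightarrow> bool" where
  "chain_below_pair P C x y \<longleftrightarrow>
     x \<noteq> y \<and> x \<notin> C \<and> y \<notin> C \<and> inj_on P C \<and>
     (\<forall>c\<in>C. proj_le (P c) (P x) \<and> proj_le (P c) (P y)) \<and>
     (\<forall>c\<in>C. \<forall>d\<in>C. proj_le (P c) (P d) \<or> proj_le (P d) (P c))"

text \<open>
  The scalar \<open>\<gamma>\<close> is arbitrary because the passage from \<open>P g\<close> to its complement
  changes it.
\<close>

locale irreducible_projections =
  fixes S :: "'a set" and P :: "'a \<Rightarrow> 'h::chilbert_space \<Rightarrow> 'h"
    and \<alpha> :: "'a \<Rightarrow> real" and \<gamma> :: real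
  assumes finite_S: "finite S"
    and proj: "g \<in> S \<Longrightarrow> orthogonal_projection (P g)"
    and irreducible: "csubspace M \<Longrightarrow> closed M \<Longrightarrow> (\<And>g. g \<in> S \<Longrightarrow> P g ` M \<subseteq> M) \<Longrightarrow>
           M = {0} \<or> M = UNIV"
    and nonzero: "g \<in> S \<Longrightarrow> P g \<noteq> (\<lambda>x. 0)"
    and nonid: "g \<in> S \<Longrightarrow> P g \<noteq> id"
    and pos: "g \<in> S \<Longrightarrow> 0 < \<alpha> g"
    and weighted_sum_S: "(\<Sum>g\<in>S. \<alpha> g *\<^sub>R P g x) = \<gamma> *\<^sub>R x"
begin

lemma P_linear: "g \<in> S \<Longrightarrow> linear (P g)"
  using proj orthogonal_projectionD(1) by blast

lemma P_simps [simp]: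
  assumes "g \<in> S"
  shows "P g (P g x) = P g x"
    and "P g 0 = 0"
    and "P g (x + y) = P g x + P g y"
    and "P g (x - y) = P g x - P g y"
    and "P g (r *\<^sub>R x) = r *\<^sub>R P g x"
    and "P g (c *\<^sub>C x) = c *\<^sub>C P g x"
    and "P g (\<Sum>i\<in>I. f i) = (\<Sum>i\<in>I. P g (f i))"
  using P_linear[OF assms] orthogonal_projectionD[OF proj[OF assms]]
  by (auto simp: linear_0 linear_add linear_diff linear_scale linear_sum)

lemma P_sym: "g \<in> S \<Longrightarrow> inner (P g x) y = inner x (P g y)"
  using proj orthogonal_projectionD(3) by blast

lemma inner_P: "g \<in> S \<Longrightarrow> inner (P g x) x = (norm (P g x))\<^sup>2"
  by (metis P_simps(1) P_sym power2_norm_eq_inner)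

lemma norm_P_complement: "g \<in> S \<Longrightarrow> (norm x)\<^sup>2 = (norm (P g x))\<^sup>2 + (norm (x - P g x))\<^sup>2"
  by (simp add: power2_norm_eq_inner inner_diff_left inner_diff_right P_sym inner_commute)

lemma obtain_in_range:
  assumes "g \<in> S"
  obtains x where "x \<noteq> 0" "P g x = x"
proof -
  obtain y where "P g y \<noteq> 0" using nonzero[OF assms] by fast
  then show ?thesis using that[of "P g y"] assms by simp
qed

lemma obtain_in_kernel:
  assumes "g \<in> S"
  obtains x where "x \<noteq> 0" "P g x = 0"
proof -
  obtain y where "P g y \<noteq> y" using nonid[OF assms] by (metis eq_id_iff)
  then show ?thesis using that[of "y - P g y"] assms by simp
qed

lemma obtain_in_difference:
  assumes "g \<in> S" "h \<in> S" "proj_le (P g) (P h)" "P g \<noteq> P h"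
  obtains x where "x \<noteq> 0" "P h x = x" "P g x = 0"
proof -
  have gh: "P g (P h y) = P g y" "P h (P g y) = P g y" for y
    using proj_leD proj_leD' proj assms by metis+
  obtain y where "P g y \<noteq> P h y" using assms(4) by blast
  then show ?thesis using that[of "P h y - P g y"] assms(1,2) gh by simp
qed

text \<open>
  Irreducibility in the form in which it is used: the orthogonal complement of \<open>X\<close> is closed and, as the
  projections are self-adjoint, invariant whenever the span of \<open>X\<close> is. This spares all questions
  about closedness of \<open>X\<close> and of its span. Invariance under complex scalars is asked of \<open>X\<close> because
  \<open>span\<close> is the real span.
\<close>

lemma orthogonal_to_invariant:
  assumes homogeneous: "\<And>c x. x \<in> X \<Longrightarrow> c *\<^sub>C x \<in> X"
    and invariant: "\<And>g x. g \<in> S \<Longrightarrow> x \<in> X \<Longrightarrow> P g x \<in> span X"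
    and "x \<in> X" "x \<noteq> 0" and orth: "\<And>x. x \<in> X \<Longrightarrow> inner x y = 0"
  shows "y = 0"
proof -
  define M where "M = {z. \<forall>x\<in>X. inner x z = 0}"
  have span: "inner u z = 0" if "u \<in> span X" "z \<in> M" for u z
    using that by (induction u rule: span_induct_alt) (auto simp: M_def inner_left_distrib)
  have "csubspace M"
    unfolding csubspace_def M_def
    by (auto simp: inner_right_distrib)
       (metis homogeneous complex_cnj_cnj inner_scaleC_left)
  moreover have "closed M"
  proof -
    have "M = (\<Inter>x\<in>X. {z. inner x z = 0})" by (auto simp: M_def)
    then show ?thesis
      by (auto intro!: closed_Collect_eq continuous_intros)
  qed
  moreover have "P g ` M \<subseteq> M" if "g \<in> S" for g
    using span invariant[OF that] P_sym[OF that] by (fastforce simp: M_def)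
  ultimately have "M = {0} \<or> M = UNIV"
    by (rule irreducible)
  moreover have "x \<notin> M"
    unfolding M_def using assms(3,4) inner_eq_zero_iff by blast
  ultimately have "M = {0}" by blast
  moreover have "y \<in> M" using orth by (simp add: M_def)
  ultimately show ?thesis by simp
qed

lemma no_invariant_in_range:
  assumes "h \<in> S" and "\<And>x. x \<in> X \<Longrightarrow> P h x = x"
    and "\<And>c x. x \<in> X \<Longrightarrow> c *\<^sub>C x \<in> X"
    and "\<And>g x. g \<in> S \<Longrightarrow> x \<in> X \<Longrightarrow> P g x \<in> X"
    and "x \<in> X" "x \<noteq> 0"
  shows False
proof -
  obtain y where y: "y \<noteq> 0" "P h y = 0" using obtain_in_kernel[OF assms(1)] .
  have "y = 0"
  proof (rule orthogonal_to_invariant)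
    show "P g z \<in> span X" if "g \<in> S" "z \<in> X" for g z
      using assms(4)[OF that] by (rule span_base)
    show "inner z y = 0" if "z \<in> X" for z
      using assms(2)[OF that] P_sym[OF assms(1), of z y] y by simp
  qed (fact assms(3,5,6))+
  then show False using y by simp
qed

section \<open>Weighted sums and their eigenvalues\<close>

definition wsum :: "'a set \<Rightarrow> 'h \<Rightarrow> 'h" where
  "wsum T x = (\<Sum>g\<in>T. \<alpha> g *\<^sub>R P g x)"

definition eigenspace :: "'a set \<Rightarrow> real \<Rightarrow> 'h set" where
  "eigenspace T \<kappa> = {x. wsum T x = \<kappa> *\<^sub>R x}"

lemma wsum_simps [simp]:
  assumes "T \<subseteq> S"
  shows "wsum T 0 = 0"
    and "wsum T (x + y) = wsum T x + wsum T y"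
    and "wsum T (x - y) = wsum T x - wsum T y"
    and "wsum T (r *\<^sub>R x) = r *\<^sub>R wsum T x"
    and "wsum T (c *\<^sub>C x) = c *\<^sub>C wsum T x"
    and "wsum {} x = 0"
proof -
  have S: "g \<in> T \<Longrightarrow> g \<in> S" for g using assms by blast
  show "wsum T 0 = 0" "wsum T (x + y) = wsum T x + wsum T y" "wsum T (x - y) = wsum T x - wsum T y"
    "wsum T (r *\<^sub>R x) = r *\<^sub>R wsum T x" "wsum T (c *\<^sub>C x) = c *\<^sub>C wsum T x" "wsum {} x = 0"
    by (simp_all add: wsum_def S sum.distrib sum_subtractf scaleR_add_right scaleR_diff_right
        scaleR_sum_right scaleC_sum scaleR_scaleC_commute mult.commute cong: sum.cong)
qed

lemma wsum_union: "T \<subseteq> S \<Longrightarrow> U \<subseteq> S \<Longrightarrow> T \<inter> U = {} \<Longrightarrow> wsum (T \<union> U) x = wsum T x + wsum U x"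
  unfolding wsum_def using finite_S by (intro sum.union_disjoint) (auto intro: finite_subset)

lemma wsum_complement:
  assumes "S = T \<union> U" "T \<inter> U = {}"
  shows "wsum U x = \<gamma> *\<^sub>R x - wsum T x"
  using wsum_union[of T U x] assms weighted_sum_S[of x] by (auto simp: wsum_def algebra_simps)

lemma wsum_pair: "x \<noteq> y \<Longrightarrow> wsum {x, y} z = \<alpha> x *\<^sub>R P x z + \<alpha> y *\<^sub>R P y z"
  by (simp add: wsum_def)

lemma wsum_sym: "T \<subseteq> S \<Longrightarrow> inner (wsum T x) y = inner x (wsum T y)"
  unfolding wsum_def by (auto simp: inner_sum_left inner_sum_right P_sym intro!: sum.cong)

lemma inner_wsum: "T \<subseteq> S \<Longrightarrow> inner (wsum T x) x = (\<Sum>g\<in>T. \<alpha> g * (norm (P g x))\<^sup>2)"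
  unfolding wsum_def by (auto simp: inner_sum_left inner_P subset_iff intro!: sum.cong)

lemma eigenvalue_nonneg:
  assumes "T \<subseteq> S" "x \<in> eigenspace T \<kappa>" "x \<noteq> 0"
  shows "0 \<le> \<kappa>"
proof -
  have "0 \<le> inner (wsum T x) x"
    unfolding inner_wsum[OF assms(1)] using assms(1) pos
    by (intro sum_nonneg mult_nonneg_nonneg) (auto intro: less_imp_le)
  also have "\<dots> = \<kappa> * (norm x)\<^sup>2"
    using assms(2) by (simp add: eigenspace_def power2_norm_eq_inner)
  finally show ?thesis
    using assms(3) by (simp add: zero_le_mult_iff)
qed

text \<open>
  The sum of the weights is the norm bound of the weighted sum; it is attained only where every single
  projection acts as the identity.
\<close>

lemma eigenvalue_le_sum:
  assumes "T \<subseteq> S" "x \<in> eigenspace T \<kappa>" "x \<noteq> 0" "sum \<alpha> T \<le> \<kappa>"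
  shows "\<kappa> = sum \<alpha> T \<and> (\<forall>g\<in>T. P g x = x)"
proof -
  have fin: "finite T" using assms(1) finite_S finite_subset by blast
  have nn: "0 \<le> \<alpha> g * (norm (x - P g x))\<^sup>2" if "g \<in> T" for g
    using pos[of g] that assms(1) by (auto intro: less_imp_le)
  have "\<kappa> * (norm x)\<^sup>2 = (\<Sum>g\<in>T. \<alpha> g * (norm (P g x))\<^sup>2)"
    using inner_wsum[OF assms(1), of x] assms(2) by (simp add: eigenspace_def power2_norm_eq_inner)
  also have "\<dots> = (\<Sum>g\<in>T. \<alpha> g * (norm x)\<^sup>2 - \<alpha> g * (norm (x - P g x))\<^sup>2)"
  proof (intro sum.cong refl)
    fix g assume "g \<in> T"
    then have "g \<in> S" using assms(1) by blast
    then show "\<alpha> g * (norm (P g x))\<^sup>2 = \<alpha> g * (norm x)\<^sup>2 - \<alpha> g * (norm (x - P g x))\<^sup>2"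
      using norm_P_complement[of g x] by (simp add: algebra_simps)
  qed
  finally have *: "(\<kappa> - sum \<alpha> T) * (norm x)\<^sup>2 + (\<Sum>g\<in>T. \<alpha> g * (norm (x - P g x))\<^sup>2) = 0"
    by (simp add: sum_subtractf sum_distrib_right algebra_simps)
  have "0 \<le> (\<kappa> - sum \<alpha> T) * (norm x)\<^sup>2" using assms(4) by simp
  moreover have "0 \<le> (\<Sum>g\<in>T. \<alpha> g * (norm (x - P g x))\<^sup>2)" by (intro sum_nonneg nn)
  ultimately have zero: "(\<kappa> - sum \<alpha> T) * (norm x)\<^sup>2 = 0" "(\<Sum>g\<in>T. \<alpha> g * (norm (x - P g x))\<^sup>2) = 0"
    using * by linarith+
  show ?thesis
  proof (intro conjI ballI)
    show "\<kappa> = sum \<alpha> T" using zero(1) assms(3) by simp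
    fix g assume g: "g \<in> T"
    have "\<alpha> g * (norm (x - P g x))\<^sup>2 = 0"
      using zero(2) g sum_nonneg_eq_0_iff[OF fin, of "\<lambda>g. \<alpha> g * (norm (x - P g x))\<^sup>2"] nn
      by blast
    moreover have "0 < \<alpha> g" using pos g assms(1) by blast
    ultimately show "P g x = x" by simp
  qed
qed

lemma eigenspace_zero:
  assumes "T \<subseteq> S" "x \<in> eigenspace T 0" "g \<in> T"
  shows "P g x = 0"
proof -
  have fin: "finite T" using assms(1) finite_S finite_subset by blast
  have "(\<Sum>g\<in>T. \<alpha> g * (norm (P g x))\<^sup>2) = 0"
    using inner_wsum[OF assms(1), of x] assms(2) by (simp add: eigenspace_def)
  moreover have nn: "0 \<le> \<alpha> g * (norm (P g x))\<^sup>2" if "g \<in> T" for g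
    using pos[of g] that assms(1) by (auto intro: less_imp_le)
  ultimately have "\<alpha> g * (norm (P g x))\<^sup>2 = 0"
    using sum_nonneg_eq_0_iff[OF fin, of "\<lambda>g. \<alpha> g * (norm (P g x))\<^sup>2"] assms(3) by blast
  moreover have "0 < \<alpha> g" using pos assms(1,3) by blast
  ultimately show ?thesis by simp
qed

lemma eigenspace_sum:
  assumes "\<And>g. g \<in> T \<Longrightarrow> P g x = x"
  shows "x \<in> eigenspace T (sum \<alpha> T)"
  using assms by (simp add: eigenspace_def wsum_def scaleR_sum_left)

lemma eigenspaces_orthogonal:
  assumes "T \<subseteq> S" "x \<in> eigenspace T \<kappa>" "y \<in> eigenspace T \<mu>" "\<kappa> \<noteq> \<mu>"
  shows "inner x y = 0"
  using wsum_sym[OF assms(1), of x y] assms(2-4) by (simp add: eigenspace_def)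

lemma eigenspace_homogeneous: "T \<subseteq> S \<Longrightarrow> x \<in> eigenspace T \<kappa> \<Longrightarrow> c *\<^sub>C x \<in> eigenspace T \<kappa>"
  by (simp add: eigenspace_def scaleR_scaleC_commute)

text \<open>
  If \<open>\<mu>\<close> were outside \<open>L\<close>, its eigenvector would be orthogonal to a nonzero invariant set.
\<close>

lemma eigenvalues_connected:
  assumes "T \<subseteq> S"
    and "\<And>\<kappa> x g. \<kappa> \<in> L \<Longrightarrow> x \<in> eigenspace T \<kappa> \<Longrightarrow> g \<in> S \<Longrightarrow>
           P g x \<in> span (\<Union>\<mu>\<in>L. eigenspace T \<mu>)"
    and "\<kappa> \<in> L" "x \<in> eigenspace T \<kappa>" "x \<noteq> 0"
    and "y \<in> eigenspace T \<mu>" "y \<noteq> 0"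
  shows "\<mu> \<in> L"
proof (rule ccontr)
  assume "\<mu> \<notin> L"
  have "y = 0"
  proof (rule orthogonal_to_invariant)
    show "x \<in> (\<Union>\<mu>\<in>L. eigenspace T \<mu>)" using assms by blast
    show "inner z y = 0" if "z \<in> (\<Union>\<mu>\<in>L. eigenspace T \<mu>)" for z
      using that assms(1,6) \<open>\<mu> \<notin> L\<close> eigenspaces_orthogonal by blast
    show "c *\<^sub>C z \<in> (\<Union>\<mu>\<in>L. eigenspace T \<mu>)" if "z \<in> (\<Union>\<mu>\<in>L. eigenspace T \<mu>)" for c z
      using that eigenspace_homogeneous[OF assms(1)] by blast
    show "P g z \<in> span (\<Union>\<mu>\<in>L. eigenspace T \<mu>)"
      if "g \<in> S" "z \<in> (\<Union>\<mu>\<in>L. eigenspace T \<mu>)" for g z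
      using that assms(2) by blast
  qed (fact assms(5))
  then show False using assms by simp
qed

text \<open>
  The polynomial \<open>\<kappa>\<^sup>2 - t \<kappa>\<close> takes the same value at \<open>\<kappa>\<close> and at its reflection
  \<open>t - \<kappa>\<close>; projections that commute with this polynomial in \<open>wsum T\<close> can mix the eigenspaces of
  these two numbers but no others.
\<close>

definition reflecting :: "'a set \<Rightarrow> real \<Rightarrow> bool" where
  "reflecting T t \<longleftrightarrow>
     (\<forall>g\<in>T. \<forall>x. P g (wsum T (wsum T x) - t *\<^sub>R wsum T x) = wsum T (wsum T (P g x)) - t *\<^sub>R wsum T (P g x))"

text \<open>
  The vector \<open>P g x\<close> is annihilated by \<open>(V - \<kappa>) (V - (t - \<kappa>))\<close>, which splits it into
  eigenvectors if the two roots differ; for a double root self-adjointness of \<open>V\<close> gives the same.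
\<close>

lemma reflectingD:
  assumes "T \<subseteq> S" "reflecting T t" "g \<in> T" "x \<in> eigenspace T \<kappa>"
  shows "P g x \<in> span (eigenspace T \<kappa> \<union> eigenspace T (t - \<kappa>))"
proof -
  define w where "w = P g x"
  have g: "g \<in> S" using assms(1,3) by blast
  have "P g (wsum T (wsum T x) - t *\<^sub>R wsum T x) = (\<kappa> * \<kappa> - t * \<kappa>) *\<^sub>R w"
    using assms(1,4) g by (simp add: eigenspace_def w_def algebra_simps)
  then have w: "wsum T (wsum T w) - t *\<^sub>R wsum T w = (\<kappa> * \<kappa> - t * \<kappa>) *\<^sub>R w"
    using assms(2,3) by (simp add: reflecting_def w_def)
  define u where "u = wsum T w - \<kappa> *\<^sub>R w"
  define v where "v = wsum T w - (t - \<kappa>) *\<^sub>R w"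
  have Wu: "wsum T u = (t - \<kappa>) *\<^sub>R u"
    using w assms(1) unfolding u_def by (simp add: algebra_simps)
  have Wv: "wsum T v = \<kappa> *\<^sub>R v"
    using w assms(1) unfolding v_def by (simp add: algebra_simps)
  show ?thesis
  proof (cases "t = 2 * \<kappa>")
    case True
    have "inner u u = inner (wsum T u - \<kappa> *\<^sub>R u) w"
      unfolding u_def using wsum_sym[OF assms(1)] by (simp add: inner_diff_left inner_diff_right)
    also have "\<dots> = 0" using Wu True by simp
    finally have "w \<in> eigenspace T \<kappa>" by (simp add: u_def eigenspace_def)
    then show ?thesis by (simp add: w_def span_base)
  next
    case False
    have "w = (1 / (2 * \<kappa> - t)) *\<^sub>R (v - u)"
      using False by (simp add: u_def v_def flip: scaleR_diff_left)
    moreover have "v - u \<in> span (eigenspace T \<kappa> \<union> eigenspace T (t - \<kappa>))"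
      using Wu Wv by (intro span_diff span_base) (auto simp: eigenspace_def)
    ultimately show ?thesis
      unfolding w_def[symmetric] by (metis span_scale)
  qed
qed

section \<open>Reflections of the spectrum\<close>

lemma reflecting_span:
  assumes "T \<subseteq> S" "reflecting T t" "g \<in> T" "x \<in> eigenspace T \<kappa>" "\<kappa> \<in> L"
    and "t - \<kappa> \<in> L \<or> eigenspace T (t - \<kappa>) \<subseteq> {0}"
  shows "P g x \<in> span (\<Union>\<mu>\<in>L. eigenspace T \<mu>)"
proof -
  have "eigenspace T \<kappa> \<union> eigenspace T (t - \<kappa>) \<subseteq> insert 0 (\<Union>\<mu>\<in>L. eigenspace T \<mu>)"
    using assms(5,6) by blast
  from span_mono[OF this] reflectingD[OF assms(1-4)] show ?thesis
    by (auto simp: span_insert_0)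
qed

lemma eigenspace_complement:
  assumes "S = T \<union> U" "T \<inter> U = {}"
  shows "eigenspace U \<kappa> = eigenspace T (\<gamma> - \<kappa>)"
  unfolding eigenspace_def wsum_complement[OF assms] by (auto simp: algebra_simps)

text \<open>
  The weighted sums of complementary parts add up to \<open>\<gamma>\<close>, so a reflection of the eigenvalues of one
  is a reflection of those of the other, with the constant \<open>2 \<gamma> - t\<close> in place of \<open>t\<close>.
\<close>

lemma reflecting_span_complement:
  assumes "S = T \<union> U" "T \<inter> U = {}" "reflecting U t" "g \<in> U" "x \<in> eigenspace T \<kappa>" "\<kappa> \<in> L"
    and "2 * \<gamma> - t - \<kappa> \<in> L \<or> eigenspace T (2 * \<gamma> - t - \<kappa>) \<subseteq> {0}"
  shows "P g x \<in> span (\<Union>\<mu>\<in>L. eigenspace T \<mu>)"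
proof -
  note E = eigenspace_complement[OF assms(1,2)]
  have "P g x \<in> span (\<Union>\<mu>\<in>(\<lambda>\<mu>. \<gamma> - \<mu>) ` L. eigenspace U \<mu>)"
  proof (rule reflecting_span[where t = t and \<kappa> = "\<gamma> - \<kappa>"])
    have "\<gamma> - (t - (\<gamma> - \<kappa>)) = 2 * \<gamma> - t - \<kappa>" by simp
    moreover have "t - (\<gamma> - \<kappa>) = \<gamma> - (2 * \<gamma> - t - \<kappa>)" by simp
    ultimately show "t - (\<gamma> - \<kappa>) \<in> (\<lambda>\<mu>. \<gamma> - \<mu>) ` L \<or> eigenspace U (t - (\<gamma> - \<kappa>)) \<subseteq> {0}"
      using assms(7) E by (metis imageI)
  qed (use assms in \<open>auto simp: E\<close>)
  then show ?thesis by (simp add: E)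
qed

lemma chain_commute:
  assumes "C \<subseteq> S" "chain_below_pair P C x y" "c \<in> C" "d \<in> C"
  shows "P c (P d z) = P d (P c z)"
proof -
  have "proj_le (P c) (P d) \<or> proj_le (P d) (P c)"
    using assms(2-4) by (simp add: chain_below_pair_def)
  moreover have "orthogonal_projection (P c)" "orthogonal_projection (P d)"
    using assms proj by auto
  ultimately show ?thesis
    using proj_leD proj_leD' by metis
qed

lemma chain_below_pair_commute: "chain_below_pair P C x y \<longleftrightarrow> chain_below_pair P C y x"
  by (auto simp: chain_below_pair_def)

lemma chain_below_pairD:
  assumes "C \<union> {x, y} \<subseteq> S" "chain_below_pair P C x y"
  shows "wsum (C \<union> {x, y}) z = wsum C z + \<alpha> x *\<^sub>R P x z + \<alpha> y *\<^sub>R P y z"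
    and "c \<in> C \<Longrightarrow> P c (P x z) = P c z" "c \<in> C \<Longrightarrow> P x (P c z) = P c z"
    and "wsum C (P x z) = wsum C z" "P x (wsum C z) = wsum C z"
    and "c \<in> C \<Longrightarrow> P c (wsum C z) = wsum C (P c z)"
proof -
  have S: "c \<in> S" if "c \<in> C" for c using that assms(1) by blast
  have xy: "x \<in> S" "y \<in> S" "x \<noteq> y" "x \<notin> C" "y \<notin> C"
    using assms by (auto simp: chain_below_pair_def)
  have le: "proj_le (P c) (P x)" if "c \<in> C" for c
    using that assms(2) by (simp add: chain_below_pair_def)
  show 1: "P c (P x z) = P c z" if "c \<in> C" for c z using proj_leD[OF le[OF that]] .
  show 2: "P x (P c z) = P c z" if "c \<in> C" for c z
    using proj_leD'[OF proj[OF S[OF that]] proj[OF xy(1)] le[OF that]] .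
  show "wsum C (P x z) = wsum C z" unfolding wsum_def by (simp add: 1)
  show "P x (wsum C z) = wsum C z" unfolding wsum_def by (simp add: 2 xy)
  show "P c (wsum C z) = wsum C (P c z)" if "c \<in> C" for c
    unfolding wsum_def using S[OF that] chain_commute[OF _ assms(2) that] assms(1) by simp
  show "wsum (C \<union> {x, y}) z = wsum C z + \<alpha> x *\<^sub>R P x z + \<alpha> y *\<^sub>R P y z"
    using wsum_union[of C "{x, y}" z] xy assms(1) by (simp add: wsum_pair)
qed

lemma chain_commutes_with_wsum:
  assumes "C \<union> {x, y} \<subseteq> S" "chain_below_pair P C x y" "c \<in> C"
  shows "P c (wsum (C \<union> {x, y}) z) = wsum (C \<union> {x, y}) (P c z)"
proof -
  note D = chain_below_pairD[OF assms(1,2)]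
  have "C \<union> {y, x} \<subseteq> S" "chain_below_pair P C y x"
    using assms chain_below_pair_commute by auto
  note D' = chain_below_pairD[OF this]
  have "c \<in> S" using assms by blast
  then show ?thesis
    unfolding D(1) by (simp add: D(6) D(2,3)[OF assms(3)] D'(2,3)[OF assms(3)] assms(3))
qed

text \<open>
  For two projections \<open>p\<close>, \<open>q\<close> and \<open>X = a p + b q\<close> one has
  \<open>X\<^sup>2 - (a + b) X = a b (p q + q p - p - q) = - a b (p - q)\<^sup>2\<close>, and \<open>(p - q)\<^sup>2\<close> commutes with
  both. The sum \<open>G\<close> over the chain satisfies \<open>G X = X G = (a + b) G\<close> and contributes only
  \<open>G\<^sup>2 + (a + b) G\<close>, which commutes with everything in the block.
\<close>

lemma chain_below_pair_reflecting:
  assumes "C \<union> {x, y} \<subseteq> S" "chain_below_pair P C x y"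
  shows "reflecting (C \<union> {x, y}) (\<alpha> x + \<alpha> y)"
proof -
  note D = chain_below_pairD[OF assms]
  have swap: "C \<union> {y, x} \<subseteq> S" "chain_below_pair P C y x"
    using assms chain_below_pair_commute by auto
  note D' = chain_below_pairD[OF swap]
  have S: "x \<in> S" "y \<in> S" "C \<subseteq> S" "\<And>c. c \<in> C \<Longrightarrow> c \<in> S" using assms(1) by auto
  let ?wsum = "wsum (C \<union> {x, y})"
  have Z: "?wsum (?wsum z) - (\<alpha> x + \<alpha> y) *\<^sub>R ?wsum z =
      wsum C (wsum C z) + (\<alpha> x + \<alpha> y) *\<^sub>R wsum C z
      + (\<alpha> x * \<alpha> y) *\<^sub>R (P x (P y z) + P y (P x z) - P x z - P y z)" for z
    unfolding D(1) by (simp add: D(4,5) D'(4,5) S algebra_simps)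
  show ?thesis
    unfolding reflecting_def Z
  proof (intro ballI allI)
    fix g z assume g: "g \<in> C \<union> {x, y}"
    consider "g = x" | "g = y" | "g \<in> C" using g by blast
    then show "P g (wsum C (wsum C z) + (\<alpha> x + \<alpha> y) *\<^sub>R wsum C z +
                (\<alpha> x * \<alpha> y) *\<^sub>R (P x (P y z) + P y (P x z) - P x z - P y z)) =
           wsum C (wsum C (P g z)) + (\<alpha> x + \<alpha> y) *\<^sub>R wsum C (P g z) +
           (\<alpha> x * \<alpha> y) *\<^sub>R (P x (P y (P g z)) + P y (P x (P g z)) - P x (P g z) - P y (P g z))"
    proof cases
      case 3
      then show ?thesis
        by (simp add: S D(6) D(2,3)[OF 3] D'(2,3)[OF 3])
    qed (simp_all add: S D(4,5) D'(4,5))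
  qed
qed

section \<open>Chains of singletons as ends of the spectrum\<close>

text \<open>
  The value of the weighted sum on those vectors in the range of \<open>P c\<close> that are orthogonal to the ranges
  of all smaller projections of the chain.
\<close>

definition chain_value :: "'a set \<Rightarrow> 'a \<Rightarrow> 'a \<Rightarrow> 'a \<Rightarrow> real" where
  "chain_value C x y c = (\<Sum>d | d \<in> C \<and> proj_le (P c) (P d). \<alpha> d) + \<alpha> x + \<alpha> y"

lemma chain_value_gt:
  assumes "C \<union> {x, y} \<subseteq> S" "c \<in> C"
  shows "\<alpha> x + \<alpha> y < chain_value C x y c"
proof -
  have "finite C" "c \<in> S" using assms finite_S finite_subset by auto
  moreover from this have "proj_le (P c) (P c)" using proj proj_le_refl by blast
  ultimately have "0 < (\<Sum>d | d \<in> C \<and> proj_le (P c) (P d). \<alpha> d)"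
    using assms pos by (intro sum_pos) auto
  then show ?thesis by (simp add: chain_value_def)
qed

lemma inj_on_chain_value:
  assumes "C \<union> {x, y} \<subseteq> S" "chain_below_pair P C x y"
  shows "inj_on (chain_value C x y) C"
proof -
  have less: "chain_value C x y d < chain_value C x y c"
    if cd: "c \<in> C" "d \<in> C" "c \<noteq> d" "proj_le (P c) (P d)" for c d
  proof -
    have S: "c \<in> S" "d \<in> S" "finite C" using cd assms(1) finite_S finite_subset by auto
    have "P c \<noteq> P d" using cd assms(2) by (auto simp: chain_below_pair_def inj_on_def)
    then have "\<not> proj_le (P d) (P c)"
      using proj_le_antisym proj S cd(4) by blast
    then have "(\<Sum>e | e \<in> C \<and> proj_le (P d) (P e). \<alpha> e) < (\<Sum>e | e \<in> C \<and> proj_le (P c) (P e). \<alpha> e)"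
      using cd S assms(1) pos proj_le_refl[OF proj[OF S(1)]] proj_le_trans[OF cd(4)]
      by (intro sum_strict_mono2[where b = c]) (auto intro: less_imp_le)
    then show ?thesis by (simp add: chain_value_def)
  qed
  show ?thesis
  proof (rule inj_onI, rule ccontr)
    fix c d assume cd: "c \<in> C" "d \<in> C" "chain_value C x y c = chain_value C x y d" "c \<noteq> d"
    have "proj_le (P c) (P d) \<or> proj_le (P d) (P c)"
      using assms(2) cd by (simp add: chain_below_pair_def)
    then show False using less[of c d] less[of d c] cd by auto
  qed
qed

lemma chain_value_eigenvalue:
  assumes "C \<union> {x, y} \<subseteq> S" "chain_below_pair P C x y" "c \<in> C"
  shows "\<exists>v\<in>eigenspace (C \<union> {x, y}) (chain_value C x y c). v \<noteq> 0"
proof -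
  have S: "c \<in> S" "finite C" "C \<subseteq> S" "x \<in> S" "y \<in> S" using assms finite_S finite_subset by auto
  have le: "proj_le (P d) (P x)" "proj_le (P d) (P y)" if "d \<in> C" for d
    using that assms(2) by (auto simp: chain_below_pair_def)
  have total: "proj_le (P d) (P e) \<or> proj_le (P e) (P d)" if "d \<in> C" "e \<in> C" for d e
    using that assms(2) by (simp add: chain_below_pair_def)
  \<comment> \<open>The chain has no repeated projections, so the range of the largest projection below \<open>P c\<close> leaves
    room for a vector orthogonal to it.\<close>
  define D where "D = {d \<in> C. d \<noteq> c \<and> proj_le (P d) (P c)}"
  obtain v where v: "v \<noteq> 0" "P c v = v" "\<And>d. d \<in> D \<Longrightarrow> P d v = 0"
  proof (cases "D = {}")
    case True
    then show ?thesis using that obtain_in_range[OF S(1)] by (metis empty_iff)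
  next
    case False
    have "\<exists>m\<in>D. \<forall>d\<in>D. proj_le (P d) (P m)"
    proof (rule finite_total_has_greatest)
      show "finite D" using S(2) by (simp add: D_def)
    qed (use False total proj_le_trans in \<open>auto simp: D_def\<close>)
    then obtain m where m: "m \<in> D" "\<And>d. d \<in> D \<Longrightarrow> proj_le (P d) (P m)" by blast
    have "m \<in> C" "m \<in> S" "m \<noteq> c" "proj_le (P m) (P c)" using m(1) S by (auto simp: D_def)
    moreover from this have "P m \<noteq> P c"
      using assms(2,3) by (auto simp: chain_below_pair_def inj_on_def)
    ultimately obtain v where v: "v \<noteq> 0" "P c v = v" "P m v = 0"
      using obtain_in_difference[of m c] S(1) by blast
    have "P d v = 0" if "d \<in> D" for d
    proof -
      have "d \<in> S" using that S(3) by (auto simp: D_def)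
      then show ?thesis using proj_leD[OF m(2)[OF that], of v] v(3) by simp
    qed
    then show ?thesis using that v by blast
  qed
  have fixed: "P d v = v" if "d \<in> S" "proj_le (P c) (P d)" for d
    using proj_leD'[OF proj[OF S(1)] proj[OF that(1)] that(2), of v] v(2) by simp
  have "wsum C v = (\<Sum>d\<in>C. (if proj_le (P c) (P d) then \<alpha> d else 0) *\<^sub>R v)"
    unfolding wsum_def
  proof (rule sum.cong[OF refl])
    fix d assume d: "d \<in> C"
    show "\<alpha> d *\<^sub>R P d v = (if proj_le (P c) (P d) then \<alpha> d else 0) *\<^sub>R v"
    proof (cases "proj_le (P c) (P d)")
      case True
      then show ?thesis using fixed[of d] d S by auto
    next
      case False
      then have "proj_le (P d) (P c)" "d \<noteq> c"
        using total[OF d assms(3)] proj_le_refl[OF proj[OF S(1)]] by auto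
      then show ?thesis using v(3)[of d] d False by (simp add: D_def)
    qed
  qed
  also have "\<dots> = (\<Sum>d | d \<in> C \<and> proj_le (P c) (P d). \<alpha> d) *\<^sub>R v"
    using S(2) by (simp add: sum.If_cases Int_def flip: scaleR_sum_left)
  finally have "v \<in> eigenspace (C \<union> {x, y}) (chain_value C x y c)"
    unfolding eigenspace_def chain_value_def chain_below_pairD(1)[OF assms(1,2)]
    using fixed[of x] fixed[of y] le[OF assms(3)] S by (simp add: algebra_simps)
  then show ?thesis using v(1) by blast
qed

definition two_chain_pairs :: "'a set \<Rightarrow> 'a \<Rightarrow> 'a \<Rightarrow> 'a set \<Rightarrow> 'a \<Rightarrow> 'a \<Rightarrow> bool" where
  "two_chain_pairs C x y C' x' y' \<longleftrightarrow>
     S = (C \<union> {x, y}) \<union> (C' \<union> {x', y'}) \<and> (C \<union> {x, y}) \<inter> (C' \<union> {x', y'}) = {} \<and>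
     chain_below_pair P C x y \<and> chain_below_pair P C' x' y'"

text \<open>
  Each singleton yields an end of the path of eigenvalues: its value exceeds the constant of the reflection
  and so is reflected to a negative number. Ends coming from different parts belong to different
  reflections, hence they are counted separately even if they are the same real number.
\<close>

lemma card_chains_le_2:
  assumes "two_chain_pairs C x y C' x' y'"
  shows "card C + card C' \<le> 2"
proof -
  define T where "T = C \<union> {x, y}"
  define U where "U = C' \<union> {x', y'}"
  have S: "S = T \<union> U" "T \<inter> U = {}" "T \<subseteq> S" "U \<subseteq> S"
    and chains: "chain_below_pair P C x y" "chain_below_pair P C' x' y'"
    using assms by (auto simp: two_chain_pairs_def T_def U_def)
  have fin: "finite C" "finite C'" using S finite_S by (auto simp: T_def U_def)
  define t where "t = \<alpha> x + \<alpha> y"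
  define u where "u = \<alpha> x' + \<alpha> y'"
  have refl: "reflecting T t" "reflecting U u"
    using chain_below_pair_reflecting S chains unfolding T_def U_def t_def u_def by auto
  define V where "V = {\<kappa>. \<exists>v\<in>eigenspace T \<kappa>. v \<noteq> 0}"
  define \<sigma> where "\<sigma> i \<kappa> = (if i then t - \<kappa> else 2 * \<gamma> - u - \<kappa>)" for i \<kappa>
  have "\<exists>p q. {(i, z). z \<in> V \<and> \<sigma> i z \<notin> V} \<subseteq> {p, q}"
  proof (rule at_most_two_ends)
    show "\<sigma> i (\<sigma> i \<kappa>) = \<kappa>" for i \<kappa> by (simp add: \<sigma>_def)
    fix L assume L: "L \<subseteq> V" "L \<noteq> {}" and closed: "\<And>i z. z \<in> L \<Longrightarrow> \<sigma> i z \<in> V \<Longrightarrow> \<sigma> i z \<in> L"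
    have closed': "\<sigma> i \<kappa> \<in> L \<or> eigenspace T (\<sigma> i \<kappa>) \<subseteq> {0}" if "\<kappa> \<in> L" for i \<kappa>
      using closed[OF that, of i] by (auto simp: V_def)
    have span: "P g v \<in> span (\<Union>\<mu>\<in>L. eigenspace T \<mu>)"
      if "\<kappa> \<in> L" "v \<in> eigenspace T \<kappa>" "g \<in> S" for \<kappa> v g
    proof (cases "g \<in> T")
      case True
      then show ?thesis
        using reflecting_span[OF S(3) refl(1) _ that(2,1)] closed'[OF that(1), of True]
        by (simp add: \<sigma>_def)
    next
      case False
      then show ?thesis
        using reflecting_span_complement[OF S(1,2) refl(2) _ that(2,1)] closed'[OF that(1), of False]
          that(3) S(1) by (auto simp: \<sigma>_def)
    qed
    obtain \<kappa> where \<kappa>: "\<kappa> \<in> L" "\<kappa> \<in> V" using L by blast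
    then obtain v where v: "v \<in> eigenspace T \<kappa>" "v \<noteq> 0" by (auto simp: V_def)
    have "\<mu> \<in> L" if \<mu>: "\<mu> \<in> V" for \<mu>
    proof -
      obtain w where w: "w \<in> eigenspace T \<mu>" "w \<noteq> 0" using \<mu> by (auto simp: V_def)
      show ?thesis by (rule eigenvalues_connected[OF S(3) _ \<kappa>(1) v w]) (rule span)
    qed
    then show "L = V" using L(1) by blast
  qed
  then obtain p q where pq: "{(i, z). z \<in> V \<and> \<sigma> i z \<notin> V} \<subseteq> {p, q}" by blast
  define E where "E = (\<lambda>c. (True, chain_value C x y c)) ` C"
  define E' where "E' = (\<lambda>c. (False, \<gamma> - chain_value C' x' y' c)) ` C'"
  have "E \<subseteq> {(i, z). z \<in> V \<and> \<sigma> i z \<notin> V}"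
  proof -
    have "chain_value C x y c \<in> V" "t - chain_value C x y c \<notin> V" if "c \<in> C" for c
    proof -
      show "chain_value C x y c \<in> V"
        using chain_value_eigenvalue[OF _ chains(1) that] S(3) by (simp add: V_def T_def)
      show "t - chain_value C x y c \<notin> V"
        using chain_value_gt[of C x y c] that S(3) eigenvalue_nonneg[OF S(3)]
        by (force simp: V_def T_def t_def)
    qed
    then show ?thesis by (auto simp: E_def \<sigma>_def)
  qed
  moreover have "E' \<subseteq> {(i, z). z \<in> V \<and> \<sigma> i z \<notin> V}"
  proof -
    note compl = eigenspace_complement[OF S(1,2)]
    have "\<gamma> - chain_value C' x' y' c \<in> V" "\<gamma> - u + chain_value C' x' y' c \<notin> V" if "c \<in> C'" for c
    proof -
      show "\<gamma> - chain_value C' x' y' c \<in> V"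
        using chain_value_eigenvalue[OF _ chains(2) that, folded U_def, OF S(4)]
        by (simp add: V_def compl[symmetric])
      have "eigenspace T (\<gamma> - u + chain_value C' x' y' c) = eigenspace U (u - chain_value C' x' y' c)"
        unfolding compl by (simp add: algebra_simps)
      then show "\<gamma> - u + chain_value C' x' y' c \<notin> V"
        using chain_value_gt[of C' x' y' c] that S(4) eigenvalue_nonneg[OF S(4)]
        by (force simp: V_def U_def u_def)
    qed
    then show ?thesis by (auto simp: E'_def \<sigma>_def algebra_simps)
  qed
  ultimately have "E \<union> E' \<subseteq> {p, q}" using pq by blast
  then have "card (E \<union> E') \<le> card {p, q}" by (intro card_mono) auto
  also have "\<dots> \<le> 2" by (simp add: card_insert_if)
  finally have "card (E \<union> E') \<le> 2" .
  moreover have "card (E \<union> E') = card E + card E'"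
    using fin by (intro card_Un_disjoint) (auto simp: E_def E'_def)
  moreover have "card E = card C"
    using inj_on_chain_value[OF _ chains(1)] S(3)
    unfolding E_def T_def by (intro card_image) (auto simp: inj_on_def)
  moreover have "card E' = card C'"
    using inj_on_chain_value[OF _ chains(2)] S(4)
    unfolding E'_def U_def by (intro card_image) (auto simp: inj_on_def)
  ultimately show ?thesis by simp
qed

section \<open>Singletons below and above pairs exclude each other\<close>

text \<open>
  On the range of the least projection of \<open>T\<close> the sum over \<open>T\<close> equals the total weight \<open>s\<close> of
  \<open>T\<close>, and positivity of the other sum gives \<open>s \<le> \<gamma>\<close>. On the kernel of the greatest projection of
  \<open>U\<close> the sum over \<open>T\<close> equals \<open>\<gamma>\<close>, which cannot exceed \<open>s\<close>. So the kernel consists of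
  vectors fixed by every projection in \<open>T\<close> and killed by every one in \<open>U\<close>.
\<close>

lemma no_least_and_greatest_across:
  assumes S: "S = T \<union> U" "T \<inter> U = {}"
    and l: "l \<in> T" "\<And>g. g \<in> T \<Longrightarrow> proj_le (P l) (P g)"
    and u: "u \<in> U" "\<And>h. h \<in> U \<Longrightarrow> proj_le (P h) (P u)"
  shows False
proof -
  have sub: "T \<subseteq> S" "U \<subseteq> S" "l \<in> S" "u \<in> S" using S l(1) u(1) by auto
  note compl = eigenspace_complement[OF S]
  obtain x where x: "x \<noteq> 0" "P u x = 0" using obtain_in_kernel[OF sub(4)] .
  obtain y where y: "y \<noteq> 0" "P l y = y" using obtain_in_range[OF sub(3)] .
  have Px: "P h x = 0" if "h \<in> U" for h
  proof -
    have "h \<in> S" using that sub by blast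
    then show ?thesis using proj_leD[OF u(2)[OF that], of x] x by simp
  qed
  have Py: "P g y = y" if "g \<in> T" for g
  proof -
    have "g \<in> S" using that sub by blast
    from proj_leD'[OF proj[OF sub(3)] proj[OF this] l(2)[OF that], of y] y(2)
    show ?thesis by simp
  qed
  have xE: "x \<in> eigenspace T \<gamma>"
    using wsum_complement[of U T x] S Px by (simp add: Un_commute Int_commute eigenspace_def wsum_def)
  have "y \<in> eigenspace T (sum \<alpha> T)" using Py by (rule eigenspace_sum)
  then have "y \<in> eigenspace U (\<gamma> - sum \<alpha> T)" unfolding compl by simp
  then have "sum \<alpha> T \<le> \<gamma>" using eigenvalue_nonneg[OF sub(2)] y(1) by fastforce
  then have fixed: "P g x = x" if "g \<in> T" for g
    using eigenvalue_le_sum[OF sub(1) xE x(1)] that by blast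
  define X where "X = {z. (\<forall>g\<in>T. P g z = z) \<and> (\<forall>h\<in>U. P h z = 0)}"
  show False
  proof (rule no_invariant_in_range)
    show "l \<in> S" by (fact sub(3))
    show "P l z = z" if "z \<in> X" for z using that l(1) by (simp add: X_def)
    show "c *\<^sub>C z \<in> X" if "z \<in> X" for c z
      using that sub by (auto simp: X_def subset_iff scaleC_zero_right)
    show "P g z \<in> X" if "g \<in> S" "z \<in> X" for g z
    proof (cases "g \<in> T")
      case False
      then have "P g z = 0" using that S(1) by (auto simp: X_def)
      then show ?thesis using sub by (auto simp: X_def subset_iff)
    qed (use that in \<open>auto simp: X_def\<close>)
    show "x \<in> X" using fixed Px by (simp add: X_def)
  qed (fact x(1))
qed

text \<open>
  The sum over \<open>T\<close> has the extreme eigenvalues \<open>0\<close> and \<open>s\<close>, attained on the kernel of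
  \<open>P u\<close> and on the range of \<open>P l\<close>. The reflection \<open>\<kappa> \<mapsto> r - \<kappa>\<close> coming from the pair must send
  both to eigenvalues, that is, to numbers between \<open>0\<close> and \<open>s\<close>. This forces \<open>r = s\<close>, so the two
  eigenspaces together are invariant and leave no room between the range of \<open>P l\<close> and that of \<open>P u\<close>.
\<close>

lemma no_least_and_greatest_beside_pair:
  assumes S: "S = T \<union> {x, y}" "T \<inter> {x, y} = {}" "x \<noteq> y"
    and l: "l \<in> T" "\<And>g. g \<in> T \<Longrightarrow> proj_le (P l) (P g)"
    and u: "u \<in> T" "\<And>g. g \<in> T \<Longrightarrow> proj_le (P g) (P u)"
    and neq: "P l \<noteq> P u"
  shows False
proof -
  have sub: "T \<subseteq> S" "l \<in> S" "u \<in> S" "{x, y} \<subseteq> S" "finite T"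
    using S l(1) u(1) finite_S by auto
  define t where "t = \<alpha> x + \<alpha> y"
  define s where "s = sum \<alpha> T"
  have "0 < s" unfolding s_def using sub pos l(1) by (intro sum_pos) auto
  have refl: "reflecting {x, y} t"
    using chain_below_pair_reflecting[of "{}" x y] sub S(3) by (simp add: t_def chain_below_pair_def)
  obtain v where v: "v \<noteq> 0" "P u v = 0" using obtain_in_kernel[OF sub(3)] .
  obtain w where w: "w \<noteq> 0" "P l w = w" using obtain_in_range[OF sub(2)] .
  obtain y' where y': "y' \<noteq> 0" "P u y' = y'" "P l y' = 0"
    using obtain_in_difference[OF sub(2,3) l(2)[OF u(1)] neq] .
  have "P g v = 0" if "g \<in> T" for g
  proof -
    have "g \<in> S" using that sub by blast
    then show ?thesis using proj_leD[OF u(2)[OF that], of v] v by simp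
  qed
  then have vE: "v \<in> eigenspace T 0" by (simp add: eigenspace_def wsum_def)
  have "P g w = w" if "g \<in> T" for g
  proof -
    have "g \<in> S" using that sub by blast
    from proj_leD'[OF proj[OF sub(2)] proj[OF this] l(2)[OF that], of w] w(2)
    show ?thesis by simp
  qed
  then have wE: "w \<in> eigenspace T s" unfolding s_def by (rule eigenspace_sum)
  have T0: "P g z = 0" if "z \<in> eigenspace T 0" "g \<in> T" for g z
    using eigenspace_zero[OF sub(1) that] .
  have Ts: "P g z = z" if "z \<in> eigenspace T s" "g \<in> T" for g z
  proof (cases "z = 0")
    case True
    then show ?thesis using that sub by auto
  next
    case False
    then show ?thesis using eigenvalue_le_sum[OF sub(1) that(1)] that(2) by (simp add: s_def)
  qed
  have span: "P g z \<in> span (\<Union>\<mu>\<in>L. eigenspace T \<mu>)"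
    if "L \<subseteq> {0, s}" "\<kappa> \<in> L" "z \<in> eigenspace T \<kappa>" "g \<in> S"
      "2 * \<gamma> - t - \<kappa> \<in> L \<or> eigenspace T (2 * \<gamma> - t - \<kappa>) \<subseteq> {0}" for L \<kappa> z g
  proof (cases "g \<in> T")
    case True
    have "\<kappa> = 0 \<or> \<kappa> = s" using that by blast
    then have "P g z = 0 \<or> P g z = z" using T0 Ts that(3) True by blast
    moreover have "z \<in> span (\<Union>\<mu>\<in>L. eigenspace T \<mu>)"
      using that(2,3) by (intro span_base) blast
    ultimately show ?thesis using span_zero by metis
  next
    case False
    then show ?thesis
      using reflecting_span_complement[OF S(1,2) refl _ that(3,2,5)] that(4) S(1) by blast
  qed
  define r where "r = 2 * \<gamma> - t"
  \<comment> \<open>Otherwise the kernel of \<open>P u\<close>, respectively the range of \<open>P l\<close> below, would be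
    invariant by itself and \<open>0\<close> or \<open>s\<close> the only eigenvalue.\<close>
  have "\<not> eigenspace T r \<subseteq> {0}"
  proof
    assume r: "eigenspace T r \<subseteq> {0}"
    have "s \<in> {0}"
      by (rule eigenvalues_connected[OF sub(1) _ _ vE v(1) wE w(1)])
         (use span[of "{0}"] r in \<open>auto simp: r_def\<close>)
    then show False using \<open>0 < s\<close> by simp
  qed
  then obtain a where a: "a \<in> eigenspace T r" "a \<noteq> 0" by blast
  have "r \<le> s" using eigenvalue_le_sum[OF sub(1) a] by (force simp: s_def)
  have "\<not> eigenspace T (r - s) \<subseteq> {0}"
  proof
    assume r: "eigenspace T (r - s) \<subseteq> {0}"
    have "0 \<in> {s}"
      by (rule eigenvalues_connected[OF sub(1) _ _ wE w(1) vE v(1)])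
         (use span[of "{s}"] r in \<open>auto simp: r_def\<close>)
    then show False using \<open>0 < s\<close> by simp
  qed
  then obtain b where b: "b \<in> eigenspace T (r - s)" "b \<noteq> 0" by blast
  have "r = s" using eigenvalue_nonneg[OF sub(1) b] \<open>r \<le> s\<close> by simp
  have "y' = 0"
  proof (rule orthogonal_to_invariant)
    let ?X = "\<Union>\<mu>\<in>{0, s}. eigenspace T \<mu>"
    show "c *\<^sub>C z \<in> ?X" if "z \<in> ?X" for c z
      using that eigenspace_homogeneous[OF sub(1)] by blast
    show "P g z \<in> span ?X" if g: "g \<in> S" "z \<in> ?X" for g z
    proof -
      obtain \<kappa> where "\<kappa> \<in> {0, s}" "z \<in> eigenspace T \<kappa>" using g by blast
      moreover from this have "2 * \<gamma> - t - \<kappa> \<in> {0, s}" using \<open>r = s\<close> by (auto simp: r_def)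
      ultimately show ?thesis using span[of "{0, s}" \<kappa> z g] g(1) by blast
    qed
    show "v \<in> ?X" using vE by blast
    show "inner z y' = 0" if "z \<in> ?X" for z
    proof -
      have "P u z = 0 \<or> P l z = z" using that T0[OF _ u(1)] Ts[OF _ l(1)] by blast
      then show ?thesis
        using P_sym[OF sub(3), of z y'] P_sym[OF sub(2), of z y'] y' by auto
    qed
  qed (fact v(1))
  then show False using y'(1) by simp
qed

section \<open>Comparabilities between the two parts\<close>

lemma two_chain_pairs_commute:
  "two_chain_pairs C x y C' x' y' \<longleftrightarrow> two_chain_pairs C' x' y' C x y"
  "two_chain_pairs C x y C' x' y' \<longleftrightarrow> two_chain_pairs C y x C' x' y'"
  unfolding two_chain_pairs_def using chain_below_pair_commute
  by (simp_all add: insert_commute Un_commute Int_commute conj_commute)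

text \<open>
  The weighted sum and all but one of its projections determine the remaining one.
\<close>

lemma other_of_pair:
  assumes "C \<union> {x, y} \<subseteq> S" "chain_below_pair P C x y" "subspace X"
    and "wsum (C \<union> {x, y}) z \<in> X" "P x z \<in> X" "\<And>c. c \<in> C \<Longrightarrow> P c z \<in> X"
  shows "P y z \<in> X"
proof -
  have "wsum C z \<in> X" unfolding wsum_def using assms(3,6) by (intro subspace_sum subspace_scale)
  moreover have "\<alpha> y *\<^sub>R P y z = wsum (C \<union> {x, y}) z - wsum C z - \<alpha> x *\<^sub>R P x z"
    using chain_below_pairD(1)[OF assms(1,2), of z] by simp
  ultimately have "\<alpha> y *\<^sub>R P y z \<in> X"
    using assms(3-5) by (simp add: subspace_diff subspace_scale)
  then have "(1 / \<alpha> y) *\<^sub>R \<alpha> y *\<^sub>R P y z \<in> X" using assms(3) subspace_scale by blast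
  then show ?thesis using pos[of y] assms(1) by simp
qed

lemma subspace_range: "g \<in> S \<Longrightarrow> subspace {z. P g z = z}"
  by (simp add: subspace_def)

context
  fixes C x y C' x' y' T U
  assumes pairs: "two_chain_pairs C x y C' x' y'"
    and T: "T = C \<union> {x, y}" and U: "U = C' \<union> {x', y'}"
begin

lemma two_chain_pairsD:
  "S = T \<union> U" "T \<inter> U = {}" "T \<subseteq> S" "U \<subseteq> S" "finite C"
  "chain_below_pair P C x y" "chain_below_pair P C' x' y'"
  "C \<union> {x, y} \<subseteq> S" "C' \<union> {x', y'} \<subseteq> S"
  using pairs finite_S by (auto simp: two_chain_pairs_def T U)

lemma wsum_other: "wsum U z = \<gamma> *\<^sub>R z - wsum T z" "wsum T z = \<gamma> *\<^sub>R z - wsum U z"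
  using wsum_complement[of T U z] two_chain_pairsD(1,2) by auto

text \<open>
  The range of the least projection of the chain is the eigenspace of \<open>wsum T\<close> for the total weight,
  where all projections in \<open>T\<close> act as the identity. The
  projections in \<open>C'\<close> commute with \<open>wsum U\<close>, hence preserve it, and those above \<open>P h\<close> act on it
  as the identity. This leaves at most one projection, which is determined by the others.
\<close>

lemma chain_not_below:
  assumes "c \<in> C" "h \<in> C' \<union> {x'}" "proj_le (P c) (P h)"
  shows False
proof -
  note D = two_chain_pairsD
  have total: "proj_le (P c) (P d) \<or> proj_le (P d) (P c)" if "c \<in> C" "d \<in> C" for c d
    using D(6) that by (simp add: chain_below_pair_def)
  have "\<exists>l\<in>C. \<forall>c\<in>C. proj_le (P l) (P c)"
    by (rule finite_total_has_greatest[OF D(5)])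
       (use assms(1) total proj_le_trans in auto)
  then obtain l where l: "l \<in> C" "\<And>c. c \<in> C \<Longrightarrow> proj_le (P l) (P c)" by blast
  have lS: "l \<in> S" using l(1) D(8) by blast
  have lT: "proj_le (P l) (P g)" if "g \<in> T" for g
    using that l D(6) by (auto simp: T chain_below_pair_def)
  have lh: "proj_le (P l) (P h)" using l(2)[OF assms(1)] assms(3) proj_le_trans by blast
  define X where "X = {z. P l z = z}"
  have fixed: "P g z = z" if "z \<in> X" "proj_le (P l) (P g)" "g \<in> S" for g z
    using proj_leD'[OF proj[OF lS] proj[OF that(3)] that(2), of z] that(1) by (simp add: X_def)
  have TX: "P g z = z" if "z \<in> X" "g \<in> T" for g z
    using fixed[OF that(1) lT[OF that(2)]] that(2) D(3) by blast
  define s where "s = sum \<alpha> T"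
  have WT: "wsum T z = s *\<^sub>R z" if "z \<in> X" for z
    using eigenspace_sum[of T z] TX[OF that] by (simp add: eigenspace_def s_def)
  have X: "z \<in> X" if "wsum T z = s *\<^sub>R z" for z
  proof (cases "z = 0")
    case False
    have "z \<in> eigenspace T s" using that by (simp add: eigenspace_def)
    from eigenvalue_le_sum[OF D(3) this False] l(1) show ?thesis by (simp add: X_def s_def T)
  qed (simp add: X_def lS)
  have sub: "subspace X" unfolding X_def by (rule subspace_range[OF lS])
  have C'X: "P c z \<in> X" if "c \<in> C'" "z \<in> X" for c z
  proof (rule X)
    have "c \<in> S" using that D(9) by blast
    have "wsum U (P c z) = P c (wsum U z)"
      unfolding U using chain_commutes_with_wsum[OF D(9,7) that(1)] by simp
    also have "wsum U z = (\<gamma> - s) *\<^sub>R z"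
      by (simp add: wsum_other(1) WT[OF that(2)] algebra_simps)
    finally show "wsum T (P c z) = s *\<^sub>R P c z"
      using \<open>c \<in> S\<close> by (simp add: wsum_other(2) algebra_simps)
  qed
  have hX: "P h z = z" if "z \<in> X" for z
    using fixed[OF that lh] assms(2) D(9) by blast
  have x'X: "P x' z \<in> X" if "z \<in> X" for z
  proof -
    have "proj_le (P h) (P x')"
      using assms(2) D(7,9) proj_le_refl proj by (auto simp: chain_below_pair_def)
    then have "P x' z = z" using fixed[OF that proj_le_trans[OF lh]] D(9) by blast
    then show ?thesis using that by simp
  qed
  obtain v where v: "v \<noteq> 0" "P l v = v" using obtain_in_range[OF lS] .
  show False
  proof (rule no_invariant_in_range[OF lS, of X])
    show "P g z \<in> X" if "g \<in> S" "z \<in> X" for g z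
    proof -
      have "P y' z \<in> X"
      proof (rule other_of_pair[OF D(9,7) sub])
        have "wsum U z = (\<gamma> - s) *\<^sub>R z" by (simp add: wsum_other(1) WT[OF that(2)] algebra_simps)
        then show "wsum (C' \<union> {x', y'}) z \<in> X" using that(2) sub by (simp add: U subspace_scale)
      qed (use x'X C'X that in auto)
      then show ?thesis using that TX[OF that(2)] x'X[OF that(2)] C'X[OF _ that(2)] D(1) by (auto simp: U)
    qed
    show "v \<in> X" "v \<noteq> 0" using v by (auto simp: X_def)
  qed (use lS in \<open>auto simp: X_def\<close>)
qed

text \<open>
  Here \<open>P h\<close> lies above \<open>P x\<close> and is comparable with everything in \<open>U\<close>, so its range is
  preserved by all projections except perhaps \<open>P y\<close>, which is then determined by the others.
\<close>

lemma pair_not_below_chain: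
  assumes "C = {}" "h \<in> C'" "proj_le (P x) (P h)"
  shows False
proof -
  note D = two_chain_pairsD
  have S: "h \<in> S" "x \<in> S" "x' \<in> S" "y' \<in> S" using assms(2) D(8,9) by auto
  define X where "X = {z. P h z = z}"
  have sub: "subspace X" unfolding X_def by (rule subspace_range[OF S(1)])
  have xX: "P x z \<in> X" for z
    using proj_leD'[OF proj[OF S(2)] proj[OF S(1)] assms(3)] by (simp add: X_def)
  have "P c z \<in> X" if "z \<in> X" "c \<in> C'" for c z
    using that chain_commute[OF _ D(7) assms(2) that(2), of z] D(9) by (simp add: X_def)
  moreover have "P x' z = z" "P y' z = z" if "z \<in> X" for z
  proof -
    have "proj_le (P h) (P x')" "proj_le (P h) (P y')"
      using assms(2) D(7) by (auto simp: chain_below_pair_def)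
    from proj_leD'[OF proj[OF S(1)] proj[OF S(3)] this(1), of z]
      proj_leD'[OF proj[OF S(1)] proj[OF S(4)] this(2), of z] that
    show "P x' z = z" "P y' z = z" by (simp_all add: X_def)
  qed
  ultimately have UX: "P g z \<in> X" if "z \<in> X" "g \<in> U" for g z
    using that by (auto simp: U)
  have yX: "P y z \<in> X" if "z \<in> X" for z
  proof (rule other_of_pair[OF D(8,6) sub])
    have "wsum U z \<in> X" unfolding wsum_def using UX[OF that] sub by (intro subspace_sum subspace_scale)
    then show "wsum (C \<union> {x, y}) z \<in> X"
      using that sub unfolding T[symmetric] wsum_other(2) by (simp add: subspace_diff subspace_scale)
  qed (use xX assms(1) in auto)
  obtain v where v: "v \<noteq> 0" "P h v = v" using obtain_in_range[OF S(1)] .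
  show False
  proof (rule no_invariant_in_range[OF S(1), of X])
    show "P g z \<in> X" if "g \<in> S" "z \<in> X" for g z
      using that UX xX yX D(1) assms(1) by (auto simp: T)
    show "v \<in> X" "v \<noteq> 0" using v by (auto simp: X_def)
  qed (use S in \<open>auto simp: X_def\<close>)
qed

text \<open>
  Let \<open>N\<close> be the largest subspace of the range of \<open>P x'\<close> that is invariant under \<open>wsum T\<close>. It
  contains the ranges of the projections in \<open>C'\<close>, as these commute with \<open>wsum T\<close> and lie below
  \<open>P x'\<close>; in particular it is not zero. It is invariant under \<open>P x\<close> by maximality: the range of
  \<open>P x\<close> lies in that of \<open>P x'\<close>, and by the identity \<open>step\<close> below \<open>N + P x N\<close> is again
  invariant under \<open>wsum T\<close>. The projections \<open>P y\<close> and \<open>P y'\<close> are determined by the others.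
\<close>

lemma pair_not_below_pair_above_chain:
  assumes "C = {}" "d \<in> C'" "proj_le (P x) (P x')"
  shows False
proof -
  note D = two_chain_pairsD
  have S: "d \<in> S" "x \<in> S" "y \<in> S" "x' \<in> S" "y' \<in> S" "x \<noteq> y"
    using assms(2) D(6,8,9) by (auto simp: chain_below_pair_def)
  have WT: "wsum T z = \<alpha> x *\<^sub>R P x z + \<alpha> y *\<^sub>R P y z" for z
    using S(6) by (simp add: T assms(1) wsum_pair)
  have lin: "linear (wsum T)" using D(3) by (intro linearI) auto
  have pow_lin: "linear (wsum T ^^ k)" for k
  proof (induction k)
    case (Suc k)
    show ?case unfolding funpow.simps by (rule linear_compose[OF Suc lin])
  qed (auto intro: linearI)
  have pow_scaleC: "(wsum T ^^ k) (c *\<^sub>C z) = c *\<^sub>C (wsum T ^^ k) z" for k c z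
    using D(3) by (induction k) auto
  have C'S: "c \<in> S" if "c \<in> C'" for c using that D(9) by blast
  have C'T: "P c (wsum T z) = wsum T (P c z)" if "c \<in> C'" for c z
    using chain_commutes_with_wsum[OF D(9,7) that, of z] C'S[OF that] by (simp add: wsum_other(2) U)
  have pow_C': "P c ((wsum T ^^ k) z) = (wsum T ^^ k) (P c z)" if "c \<in> C'" for c k z
    by (induction k) (simp_all add: C'T[OF that])
  have C'x': "P x' (P c z) = P c z" if "c \<in> C'" for c z
    using chain_below_pairD(3)[OF D(9,7) that] .
  have xx': "P x' (P x z) = P x z" for z
    using proj_leD'[OF proj[OF S(2)] proj[OF S(4)] assms(3)] .
  define N where "N = {z. \<forall>k. P x' ((wsum T ^^ k) z) = (wsum T ^^ k) z}"
  have sub: "subspace N"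
    using S(4) by (auto simp: subspace_def N_def linear_0[OF pow_lin] linear_add[OF pow_lin]
        linear_scale[OF pow_lin])
  have WN: "wsum T z \<in> N" if "z \<in> N" for z
  proof -
    have "P x' ((wsum T ^^ Suc k) z) = (wsum T ^^ Suc k) z" for k using that unfolding N_def by blast
    then show ?thesis by (simp add: N_def funpow_swap1)
  qed
  have x'N: "P x' z = z" if "z \<in> N" for z
    using that unfolding N_def by (metis (mono_tags) funpow_0 mem_Collect_eq)
  have C'N: "P c z \<in> N" if "c \<in> C'" for c z
    by (simp add: N_def pow_C'[OF that, symmetric] C'x'[OF that])
  \<comment> \<open>Expand \<open>V = a p + b q\<close>: then \<open>a (V p + p V - (a + b) p) = V\<^sup>2 - b V\<close>.\<close>
  have step: "wsum T (P x u) = P x ((\<alpha> x + \<alpha> y) *\<^sub>R u - wsum T u)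
      + (1 / \<alpha> x) *\<^sub>R (wsum T (wsum T u) - \<alpha> y *\<^sub>R wsum T u)" for u
  proof -
    have "\<alpha> x \<noteq> 0" using pos[OF S(2)] by simp
    then show ?thesis using S by (simp add: WT algebra_simps)
  qed
  have orbit: "\<forall>u\<in>N. \<forall>v\<in>N. P x' ((wsum T ^^ k) (P x u + v)) = (wsum T ^^ k) (P x u + v)" for k
  proof (induction k)
    case 0
    show ?case using S x'N xx' by simp
  next
    case (Suc k)
    show ?case
    proof (intro ballI)
      fix u v assume uv: "u \<in> N" "v \<in> N"
      define u' where "u' = (\<alpha> x + \<alpha> y) *\<^sub>R u - wsum T u"
      define v' where "v' = (1 / \<alpha> x) *\<^sub>R (wsum T (wsum T u) - \<alpha> y *\<^sub>R wsum T u) + wsum T v"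
      have "u' \<in> N" "v' \<in> N"
        unfolding u'_def v'_def using uv WN sub
        by (auto intro!: subspace_add subspace_diff subspace_scale)
      moreover have "wsum T (P x u + v) = P x u' + v'"
        using step[of u] D(3) by (simp add: u'_def v'_def)
      ultimately show "P x' ((wsum T ^^ Suc k) (P x u + v)) = (wsum T ^^ Suc k) (P x u + v)"
        using Suc by (simp add: funpow_swap1)
    qed
  qed
  have xN: "P x u \<in> N" if "u \<in> N" for u
  proof -
    have "P x' ((wsum T ^^ k) (P x u + 0)) = (wsum T ^^ k) (P x u + 0)" for k
      using orbit that subspace_0[OF sub] by blast
    then show ?thesis by (simp add: N_def)
  qed
  have yN: "P y z \<in> N" if "z \<in> N" for z
    by (rule other_of_pair[OF D(8,6) sub])
       (use WN[OF that] xN[OF that] assms(1) in \<open>auto simp: T\<close>)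
  have y'N: "P y' z \<in> N" if "z \<in> N" for z
  proof (rule other_of_pair[OF D(9,7) sub])
    show "wsum (C' \<union> {x', y'}) z \<in> N"
      using WN[OF that] that sub unfolding U[symmetric] wsum_other(1)
      by (simp add: subspace_diff subspace_scale)
  qed (use x'N[OF that] C'N that in auto)
  obtain v where v: "v \<noteq> 0" "P d v = v" using obtain_in_range[OF S(1)] .
  show False
  proof (rule no_invariant_in_range[OF S(4), of N])
    show "P g z \<in> N" if "g \<in> S" "z \<in> N" for g z
    proof -
      have "g \<in> {x, y} \<union> (C' \<union> {x', y'})" using that(1) D(1) by (simp add: T U assms(1))
      then show ?thesis using xN yN y'N C'N x'N that(2) by auto
    qed
    show "v \<in> N" using C'N[OF assms(2), of v] v by simp
    show "c *\<^sub>C z \<in> N" if "z \<in> N" for c z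
      using that S(4) by (simp add: N_def pow_scaleC)
  qed (use v x'N in auto)
qed

text \<open>
  Without singletons the four projections are regrouped: the chain \<open>P x\<close>, \<open>P x'\<close> on one side and the
  pair \<open>P y\<close>, \<open>P y'\<close> on the other. The weighted sum of the chain has the three distinct eigenvalues
  \<open>\<alpha> x + \<alpha> x'\<close>, \<open>\<alpha> x'\<close> and \<open>0\<close>. Its eigenspaces are invariant under the chain and only
  the pair reflects them, so there can be at most two.
\<close>

lemma pair_not_below_pair:
  assumes "C = {}" "C' = {}" "proj_le (P x) (P x')" "P x \<noteq> P x'"
  shows False
proof -
  note D = two_chain_pairsD
  have S: "x \<in> S" "y \<in> S" "x' \<in> S" "y' \<in> S" "x \<noteq> x'" "y \<noteq> y'"
    using D by (auto simp: T U)
  define Q where "Q = {x, x'}"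
  define R where "R = {y, y'}"
  have QR: "S = Q \<union> R" "Q \<inter> R = {}" "Q \<subseteq> S" "R \<subseteq> S"
    using D assms(1,2) by (auto simp: T U Q_def R_def chain_below_pair_def)
  have refl: "reflecting R (\<alpha> y + \<alpha> y')"
    using chain_below_pair_reflecting[of "{}" y y'] S QR(4)
    by (simp add: R_def chain_below_pair_def)
  have WQ: "wsum Q z = \<alpha> x *\<^sub>R P x z + \<alpha> x' *\<^sub>R P x' z" for z
    using S(5) by (simp add: Q_def wsum_pair)
  have le: "P x (P x' z) = P x z" "P x' (P x z) = P x z" for z
    using proj_leD[OF assms(3)] proj_leD'[OF proj[OF S(1)] proj[OF S(3)] assms(3)] by auto
  have Q_inv: "P g z \<in> eigenspace Q \<kappa>" if "g \<in> Q" "z \<in> eigenspace Q \<kappa>" for g z \<kappa>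
  proof -
    have "g = x \<or> g = x'" using that(1) by (simp add: Q_def)
    then have "wsum Q (P g z) = P g (wsum Q z)" unfolding WQ using S le by auto
    then show ?thesis using that QR(3) by (auto simp: eigenspace_def)
  qed
  define \<kappa>0 where "\<kappa>0 = \<alpha> x + \<alpha> x'"
  define r where "r = 2 * \<gamma> - (\<alpha> y + \<alpha> y')"
  define L where "L = {\<kappa>0, r - \<kappa>0}"
  obtain v where v: "v \<noteq> 0" "P x v = v" using obtain_in_range[OF S(1)] .
  have vE: "v \<in> eigenspace Q \<kappa>0"
    using v(2) le(2)[of v] by (simp add: eigenspace_def WQ \<kappa>0_def algebra_simps)
  obtain w where w: "w \<noteq> 0" "P x' w = w" "P x w = 0"
    using obtain_in_difference[OF S(1,3) assms(3,4)] .
  have wE: "w \<in> eigenspace Q (\<alpha> x')" using w by (simp add: eigenspace_def WQ)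
  obtain a where a: "a \<noteq> 0" "P x' a = 0" using obtain_in_kernel[OF S(3)] .
  have aE: "a \<in> eigenspace Q 0"
    using le(1)[of a] a S(1) by (simp add: eigenspace_def WQ)
  have span: "P g z \<in> span (\<Union>\<mu>\<in>L. eigenspace Q \<mu>)"
    if "\<kappa> \<in> L" "z \<in> eigenspace Q \<kappa>" "g \<in> S" for \<kappa> z g
  proof (cases "g \<in> Q")
    case True
    then show ?thesis using Q_inv[OF True that(2)] that(1) by (intro span_base) blast
  next
    case False
    have "2 * \<gamma> - (\<alpha> y + \<alpha> y') - \<kappa> \<in> L" using that(1) by (auto simp: L_def r_def)
    then show ?thesis
      using reflecting_span_complement[OF QR(1,2) refl _ that(2,1)] False that(3) QR(1) by blast
  qed
  have L: "\<mu> \<in> L" if "z \<in> eigenspace Q \<mu>" "z \<noteq> 0" for z \<mu>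
    by (rule eigenvalues_connected[OF QR(3) _ _ vE v(1) that])
       (use span in \<open>auto simp: L_def\<close>)
  have "\<alpha> x' \<in> L" "0 \<in> L" using L[OF wE w(1)] L[OF aE a(1)] by auto
  then show False using pos[OF S(1)] pos[OF S(3)] by (auto simp: L_def \<kappa>0_def)
qed

lemma not_below_first_of_pair:
  assumes "g \<in> C \<union> {x}" "h \<in> C' \<union> {x'}" "proj_le (P g) (P h)" "P g \<noteq> P h"
  shows False
proof (cases "C = {}")
  case True
  then have "g = x" using assms(1) by simp
  then show ?thesis
    using True assms pair_not_below_chain pair_not_below_pair_above_chain pair_not_below_pair by blast
next
  case False
  then obtain c where c: "c \<in> C" by blast
  have "\<exists>c\<in>C. proj_le (P c) (P g)"
    using assms(1) c two_chain_pairsD(6,8) proj_le_refl proj by (auto simp: chain_below_pair_def)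
  then show ?thesis using chain_not_below[OF _ assms(2)] proj_le_trans assms(3) by blast
qed

end

lemma no_relation_across:
  assumes "two_chain_pairs C x y C' x' y'"
    and "g \<in> C \<union> {x, y}" "h \<in> C' \<union> {x', y'}" "proj_le (P g) (P h)" "P g \<noteq> P h"
  shows False
proof -
  have 1: "two_chain_pairs C y x C' x' y'" "two_chain_pairs C x y C' y' x'"
    "two_chain_pairs C y x C' y' x'"
    using assms(1) two_chain_pairs_commute by metis+
  consider "g \<in> C \<union> {x}" "h \<in> C' \<union> {x'}" | "g \<in> C \<union> {x}" "h \<in> C' \<union> {y'}"
    | "g \<in> C \<union> {y}" "h \<in> C' \<union> {x'}" | "g \<in> C \<union> {y}" "h \<in> C' \<union> {y'}"
    using assms(2,3) by blast
  then show ?thesis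
    by cases (use 1 assms(1,4,5) not_below_first_of_pair[OF _ refl refl] in blast)+
qed

end

text \<open>
  Passing to complements reverses inclusions of ranges and turns what is proved for chains below the pairs
  into statements about chains above them.
\<close>

lemma (in irreducible_projections) complements:
  "irreducible_projections S (\<lambda>g x. x - P g x) \<alpha> (sum \<alpha> S - \<gamma>)"
proof
  show "orthogonal_projection (\<lambda>x. x - P g x)" if "g \<in> S" for g
    using proj[OF that] by (rule orthogonal_projection_complement)
  show "M = {0} \<or> M = UNIV"
    if M: "csubspace M" "closed M" and inv: "\<And>g. g \<in> S \<Longrightarrow> (\<lambda>x. x - P g x) ` M \<subseteq> M" for M
  proof (rule irreducible[OF M])
    fix g assume g: "g \<in> S"
    have "P g x \<in> M" if "x \<in> M" for x
    proof -
      have "x - P g x \<in> M" using inv[OF g] that by blast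
      then have "x + (- 1) *\<^sub>C (x - P g x) \<in> M"
        using M(1) that unfolding csubspace_def by blast
      moreover have "(- 1) *\<^sub>C (x - P g x) = - (x - P g x)"
        using scaleR_scaleC[of "- 1" "x - P g x"] by simp
      ultimately show ?thesis by simp
    qed
    then show "P g ` M \<subseteq> M" by blast
  qed
  show "(\<lambda>x. x - P g x) \<noteq> (\<lambda>x. 0)" if "g \<in> S" for g
  proof
    assume "(\<lambda>x. x - P g x) = (\<lambda>x. 0)"
    then have "P g = id" by (simp add: fun_eq_iff)
    then show False using nonid[OF that] by simp
  qed
  show "(\<lambda>x. x - P g x) \<noteq> id" if "g \<in> S" for g
  proof
    assume "(\<lambda>x. x - P g x) = id"
    then have "P g = (\<lambda>x. 0)" by (simp add: fun_eq_iff)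
    then show False using nonzero[OF that] by simp
  qed
  show "(\<Sum>g\<in>S. \<alpha> g *\<^sub>R (x - P g x)) = (sum \<alpha> S - \<gamma>) *\<^sub>R x" for x
    by (simp add: scaleR_diff_right sum_subtractf weighted_sum_S scaleR_diff_left scaleR_sum_left)
qed (use finite_S pos in auto)

section \<open>Classification of the order\<close>

text \<open>
  A relation in place of the order lets one classification serve for an order and for its converse.
\<close>

definition relation_isomorphic :: "('a \<Rightarrow> 'a \<Rightarrow> bool) \<Rightarrow> 'a set \<Rightarrow> nat \<Rightarrow> (nat \<times> nat) set \<Rightarrow> bool" where
  "relation_isomorphic r S n R \<longleftrightarrow>
     (\<exists>g. bij_betw g {1..n} S \<and> (\<forall>i\<in>{1..n}. \<forall>j\<in>{1..n}. r (g i) (g j) \<longleftrightarrow> (i, j) \<in> R\<^sup>*))"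

lemma relation_isomorphic_le:
  "relation_isomorphic (\<le>) S n R \<Longrightarrow> isomorphic_to_generated_poset S n R"
  by (simp add: relation_isomorphic_def isomorphic_to_generated_poset_def)

lemma relation_isomorphic_ge:
  "relation_isomorphic (\<lambda>a b. b \<le> a) S n R \<Longrightarrow> isomorphic_to_generated_poset S n (R\<inverse>)"
  unfolding relation_isomorphic_def isomorphic_to_generated_poset_def rtrancl_converse
  by blast

lemma relation_isomorphicI:
  assumes xs: "distinct xs" "set xs = S" "length xs = n"
    and Q: "trans Q" "R \<subseteq> Q" "Q \<subseteq> R\<^sup>+"
    and r: "\<And>i j. i \<in> {1..n} \<Longrightarrow> j \<in> {1..n} \<Longrightarrow> r (xs ! (i - 1)) (xs ! (j - 1)) \<longleftrightarrow> i = j \<or> (i, j) \<in> Q"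
  shows "relation_isomorphic r S n R"
proof -
  have "R\<^sup>+ \<subseteq> Q\<^sup>+" using trancl_mono Q(2) by auto
  then have "R\<^sup>+ = Q" using Q(1,3) by (simp add: trancl_id)
  then have R: "(i, j) \<in> R\<^sup>* \<longleftrightarrow> i = j \<or> (i, j) \<in> Q" for i j
    by (metis rtrancl_eq_or_trancl)
  have "bij_betw (\<lambda>i. i - 1) {1..n} {..<n}"
    by (rule bij_betwI[where g = Suc]) auto
  then have "bij_betw ((!) xs \<circ> (\<lambda>i. i - 1)) {1..n} S"
    using bij_betw_nth[OF xs(1) refl refl] xs by (auto intro: bij_betw_trans)
  then show ?thesis
    unfolding relation_isomorphic_def R using r by (intro exI[of _ "(!) xs \<circ> (\<lambda>i. i - 1)"]) simp
qed

text \<open>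
  Only the comparabilities are recorded, without transitivity or antisymmetry, so that the order and its converse
  qualify directly.
\<close>

definition pair_below_chain :: "('a \<Rightarrow> 'a \<Rightarrow> bool) \<Rightarrow> 'a \<Rightarrow> 'a \<Rightarrow> 'a set \<Rightarrow> bool" where
  "pair_below_chain r x y V \<longleftrightarrow>
     x \<noteq> y \<and> \<not> r x y \<and> \<not> r y x \<and> (\<forall>v\<in>V. r x v \<and> r y v \<and> \<not> r v x \<and> \<not> r v y) \<and>
     (\<forall>a\<in>V. \<forall>b\<in>V. a \<noteq> b \<longrightarrow> (r a b \<and> \<not> r b a) \<or> (r b a \<and> \<not> r a b))"

lemma interval_numerals:
  "{1..4::nat} = {1, 2, 3, 4}" "{1..5::nat} = {1, 2, 3, 4, 5}" "{1..6::nat} = {1, 2, 3, 4, 5, 6}"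
  by auto

lemma classify_longer_first:
  assumes "finite V" "finite V'" "card V + card V' \<le> 2" "card V' \<le> card V"
    and refl: "\<And>a. r a a"
    and V: "pair_below_chain r x y V" and V': "pair_below_chain r x' y' V'"
    and cross: "\<forall>a\<in>{x, y} \<union> V. \<forall>b\<in>{x', y'} \<union> V'. \<not> r a b \<and> \<not> r b a"
    and S: "S = ({x, y} \<union> V) \<union> ({x', y'} \<union> V')"
  shows "relation_isomorphic r S 4 {} \<or>
         relation_isomorphic r S 5 {(1, 5), (2, 5)} \<or>
         relation_isomorphic r S 6 {(1, 5), (2, 5), (5, 6)} \<or>
         relation_isomorphic r S 6 {(1, 5), (2, 5), (3, 6), (4, 6)}"
proof -
  have V_neq: "\<forall>v\<in>V. x \<noteq> v \<and> y \<noteq> v" and V'_neq: "\<forall>v\<in>V'. x' \<noteq> v \<and> y' \<noteq> v"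
    using V V' refl unfolding pair_below_chain_def by metis+
  have cross_neq: "\<forall>a\<in>{x, y} \<union> V. \<forall>b\<in>{x', y'} \<union> V'. a \<noteq> b"
    using cross refl by metis
  have xy: "x \<noteq> y" "x' \<noteq> y'" using V V' by (simp_all add: pair_below_chain_def)
  consider "card V = 0" "card V' = 0" | "card V = 1" "card V' = 0" | "card V = 1" "card V' = 1"
    | "card V = 2" "card V' = 0"
    using assms(3,4) by linarith
  then show ?thesis
  proof cases
    case 1
    then have e: "V = {}" "V' = {}" using assms(1,2) by auto
    note rel = V[unfolded e pair_below_chain_def, simplified] V'[unfolded e pair_below_chain_def, simplified]
      cross[unfolded e, simplified]
    have "relation_isomorphic r S 4 {}"
    proof (rule relation_isomorphicI[where Q = "{}" and xs = "[x, y, x', y']"])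
      show "distinct [x, y, x', y']" using cross_neq xy unfolding e by auto
      show "set [x, y, x', y'] = S" unfolding S e by auto
      show "r ([x, y, x', y'] ! (i - 1)) ([x, y, x', y'] ! (j - 1)) \<longleftrightarrow> i = j \<or> (i, j) \<in> {}"
        if "i \<in> {1..4}" "j \<in> {1..4}" for i j
        using that unfolding interval_numerals
        by (elim insertE emptyE) (simp_all add: rel refl)
    qed auto
    then show ?thesis by blast
  next
    case 2
    then obtain c where e: "V = {c}" "V' = {}" using assms(1,2) by (auto simp: card_1_singleton_iff)
    note rel = V[unfolded e pair_below_chain_def, simplified] V'[unfolded e pair_below_chain_def, simplified]
      cross[unfolded e, simplified]
    have "relation_isomorphic r S 5 {(1, 5), (2, 5)}"
    proof (rule relation_isomorphicI[where Q = "{(1, 5), (2, 5)}" and xs = "[x, y, x', y', c]"])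
      show "distinct [x, y, x', y', c]" using cross_neq xy V_neq unfolding e by auto
      show "set [x, y, x', y', c] = S" unfolding S e by auto
      show "r ([x, y, x', y', c] ! (i - 1)) ([x, y, x', y', c] ! (j - 1)) \<longleftrightarrow>
            i = j \<or> (i, j) \<in> {(1, 5), (2, 5)}"
        if "i \<in> {1..5}" "j \<in> {1..5}" for i j
        using that unfolding interval_numerals
        by (elim insertE emptyE) (simp_all add: rel refl)
    qed (auto simp: trans_def)
    then show ?thesis by blast
  next
    case 3
    then obtain c c' where e: "V = {c}" "V' = {c'}"
      using assms(1,2) by (auto simp: card_1_singleton_iff)
    note rel = V[unfolded e pair_below_chain_def, simplified] V'[unfolded e pair_below_chain_def, simplified]
      cross[unfolded e, simplified]
    have "relation_isomorphic r S 6 {(1, 5), (2, 5), (3, 6), (4, 6)}"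
    proof (rule relation_isomorphicI[where Q = "{(1, 5), (2, 5), (3, 6), (4, 6)}"
          and xs = "[x, y, x', y', c, c']"])
      show "distinct [x, y, x', y', c, c']" using cross_neq xy V_neq V'_neq unfolding e by auto
      show "set [x, y, x', y', c, c'] = S" unfolding S e by auto
      show "r ([x, y, x', y', c, c'] ! (i - 1)) ([x, y, x', y', c, c'] ! (j - 1)) \<longleftrightarrow>
            i = j \<or> (i, j) \<in> {(1, 5), (2, 5), (3, 6), (4, 6)}"
        if "i \<in> {1..6}" "j \<in> {1..6}" for i j
        using that unfolding interval_numerals
        by (elim insertE emptyE) (simp_all add: rel refl)
    qed (auto simp: trans_def)
    then show ?thesis by blast
  next
    case 4
    then obtain c d where cd: "V = {c, d}" "c \<noteq> d" "V' = {}" using assms(1,2) by (auto simp: card_2_iff)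
    obtain a b where e: "V = {a, b}" "V' = {}" "a \<noteq> b" "r a b" "\<not> r b a"
    proof -
      have "(r c d \<and> \<not> r d c) \<or> (r d c \<and> \<not> r c d)"
        using V cd by (simp add: pair_below_chain_def)
      then show thesis using that[of c d] that[of d c] cd by auto
    qed
    note rel = V[unfolded e(1,2) pair_below_chain_def, simplified] V'[unfolded e(1,2) pair_below_chain_def, simplified]
      cross[unfolded e(1,2), simplified]
    have "relation_isomorphic r S 6 {(1, 5), (2, 5), (5, 6)}"
    proof (rule relation_isomorphicI[where Q = "{(1, 5), (2, 5), (5, 6), (1, 6), (2, 6)}"
          and xs = "[x, y, x', y', a, b]"])
      show "distinct [x, y, x', y', a, b]" using cross_neq xy V_neq e(3) unfolding e(1,2) by auto
      show "set [x, y, x', y', a, b] = S" unfolding S e(1,2) by auto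
      show "r ([x, y, x', y', a, b] ! (i - 1)) ([x, y, x', y', a, b] ! (j - 1)) \<longleftrightarrow>
            i = j \<or> (i, j) \<in> {(1, 5), (2, 5), (5, 6), (1, 6), (2, 6)}"
        if "i \<in> {1..6}" "j \<in> {1..6}" for i j
        using that unfolding interval_numerals
        by (elim insertE emptyE) (simp_all add: rel refl e(3-))
      show "{(1, 5), (2, 5), (5, 6), (1, 6), (2, 6)} \<subseteq> {(1 :: nat, 5 :: nat), (2, 5), (5, 6)}\<^sup>+"
        by (auto intro: trancl_into_trancl)
    qed (auto simp: trans_def)
    then show ?thesis by blast
  qed
qed

lemma classify:
  assumes "finite V" "finite V'" "card V + card V' \<le> 2"
    and "\<And>a. r a a"
    and "pair_below_chain r x y V" "pair_below_chain r x' y' V'"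
    and "\<And>a b. a \<in> {x, y} \<union> V \<Longrightarrow> b \<in> {x', y'} \<union> V' \<Longrightarrow> \<not> r a b \<and> \<not> r b a"
    and "S = ({x, y} \<union> V) \<union> ({x', y'} \<union> V')"
  shows "relation_isomorphic r S 4 {} \<or>
         relation_isomorphic r S 5 {(1, 5), (2, 5)} \<or>
         relation_isomorphic r S 6 {(1, 5), (2, 5), (5, 6)} \<or>
         relation_isomorphic r S 6 {(1, 5), (2, 5), (3, 6), (4, 6)}"
proof (cases "card V' \<le> card V")
  case True
  show ?thesis
    by (rule classify_longer_first[OF assms(1-3) True assms(4-6) _ assms(8)]) (use assms(7) in blast)
next
  case False
  show ?thesis
    by (rule classify_longer_first[OF assms(2,1) _ _ assms(4,6,5)])
       (use False assms(3,7,8) in \<open>auto simp: Un_commute\<close>)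
qed

section \<open>Essential posets\<close>

definition chains_around_pair :: "'a::order set \<Rightarrow> 'a set \<Rightarrow> 'a \<Rightarrow> 'a \<Rightarrow> 'a set \<Rightarrow> bool" where
  "chains_around_pair T L x y V \<longleftrightarrow>
     T = L \<union> {x, y} \<union> V \<and> \<not> x \<le> y \<and> \<not> y \<le> x \<and>
     (\<forall>l\<in>L. l < x \<and> l < y) \<and> (\<forall>v\<in>V. x < v \<and> y < v) \<and>
     (\<forall>a\<in>L. \<forall>b\<in>L. a \<le> b \<or> b \<le> a) \<and> (\<forall>a\<in>V. \<forall>b\<in>V. a \<le> b \<or> b \<le> a)"

lemma unitarily_one_parameter_chains:
  assumes "unitarily_one_parameter T"
  shows "\<exists>L x y V. chains_around_pair T L x y V"
proof -
  obtain m :: nat and B where T: "T = (\<Union>i\<in>{1..m}. B i)"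
    and less: "\<forall>i\<in>{1..m}. \<forall>j\<in>{1..m}. i < j \<longrightarrow> (\<forall>x\<in>B i. \<forall>y\<in>B j. x < y)"
    and ex: "\<exists>k\<in>{1..m}. (\<exists>x y. B k = {x, y} \<and> \<not> x \<le> y \<and> \<not> y \<le> x) \<and>
           (\<forall>i\<in>{1..m} - {k}. \<exists>x. B i = {x})"
    using assms unfolding unitarily_one_parameter_def
    by (elim exE conjE) (rule that; assumption)
  obtain k x y where k: "k \<in> {1..m}" and xy: "B k = {x, y}" "\<not> x \<le> y" "\<not> y \<le> x"
    and single: "\<And>i. i \<in> {1..m} - {k} \<Longrightarrow> \<exists>x. B i = {x}"
    using ex by blast
  define L where "L = (\<Union>i\<in>{1..<k}. B i)"
  define V where "V = (\<Union>i\<in>{k<..m}. B i)"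
  have lt: "a < b" if "i \<in> {1..m}" "j \<in> {1..m}" "i < j" "a \<in> B i" "b \<in> B j" for i j a b
    using less that by blast
  have total: "a \<le> b \<or> b \<le> a"
    if "i \<in> {1..m} - {k}" "j \<in> {1..m} - {k}" "a \<in> B i" "b \<in> B j" for i j a b
  proof -
    consider "i < j" | "j < i" | "i = j" by linarith
    then show ?thesis
    proof cases
      case 1
      then show ?thesis using lt[of i j a b] that by (simp add: less_imp_le)
    next
      case 2
      then show ?thesis using lt[of j i b a] that by (simp add: less_imp_le)
    next
      case 3
      then show ?thesis using single[OF that(1)] that(3,4) by auto
    qed
  qed
  have "{1..m} = {1..<k} \<union> {k} \<union> {k<..m}" using k by auto
  then have "T = L \<union> {x, y} \<union> V" using xy(1) by (auto simp: T L_def V_def)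
  moreover have "l < x \<and> l < y" if l: "l \<in> L" for l
  proof -
    obtain i where "i \<in> {1..<k}" "l \<in> B i" using l by (auto simp: L_def)
    moreover from this have "i \<in> {1..m}" "i < k" using k by auto
    ultimately show ?thesis using less k xy(1) by blast
  qed
  moreover have "x < v \<and> y < v" if v: "v \<in> V" for v
  proof -
    obtain i where "i \<in> {k<..m}" "v \<in> B i" using v by (auto simp: V_def)
    moreover from this have "i \<in> {1..m}" "k < i" using k by auto
    ultimately show ?thesis using less k xy(1) by blast
  qed
  moreover have "a \<le> b \<or> b \<le> a" if "a \<in> L" "b \<in> L" for a b
  proof -
    obtain i j where ij: "i \<in> {1..<k}" "j \<in> {1..<k}" "a \<in> B i" "b \<in> B j"
      using \<open>a \<in> L\<close> \<open>b \<in> L\<close> by (auto simp: L_def)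
    show ?thesis by (rule total[of i j]) (use ij k in auto)
  qed
  moreover have "a \<le> b \<or> b \<le> a" if "a \<in> V" "b \<in> V" for a b
  proof -
    obtain i j where ij: "i \<in> {k<..m}" "j \<in> {k<..m}" "a \<in> B i" "b \<in> B j"
      using \<open>a \<in> V\<close> \<open>b \<in> V\<close> by (auto simp: V_def)
    show ?thesis by (rule total[of i j]) (use ij k in auto)
  qed
  ultimately have "chains_around_pair T L x y V"
    using xy(2,3) by (simp add: chains_around_pair_def)
  then show ?thesis by blast
qed

lemma chains_around_pair_least:
  assumes "chains_around_pair T L x y V" "finite L" "L \<noteq> {}"
  shows "\<exists>l\<in>L. \<forall>g\<in>T. l \<le> g"
proof -
  have "\<exists>l\<in>L. \<forall>c\<in>L. l \<le> c"
    by (rule finite_total_has_greatest[OF assms(2,3)])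
       (use assms(1) in \<open>auto simp: chains_around_pair_def\<close>)
  then obtain l where l: "l \<in> L" "\<forall>c\<in>L. l \<le> c" by blast
  have "l \<le> g" if "g \<in> T" for g
  proof -
    have "l < x" "l < y" "g \<in> L \<or> g = x \<or> g = y \<or> x < g"
      using assms(1) l(1) that by (auto simp: chains_around_pair_def)
    then show ?thesis using l(2) by (meson less_imp_le less_trans)
  qed
  then show ?thesis using l(1) by blast
qed

lemma chains_around_pair_greatest:
  assumes "chains_around_pair T L x y V" "finite V" "V \<noteq> {}"
  shows "\<exists>u\<in>V. \<forall>g\<in>T. g \<le> u"
proof -
  have "\<exists>u\<in>V. \<forall>c\<in>V. c \<le> u"
    by (rule finite_total_has_greatest[OF assms(2,3)])
       (use assms(1) in \<open>auto simp: chains_around_pair_def\<close>)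
  then obtain u where u: "u \<in> V" "\<forall>c\<in>V. c \<le> u" by blast
  have "g \<le> u" if "g \<in> T" for g
  proof -
    have "x < u" "y < u" "g \<in> V \<or> g = x \<or> g = y \<or> g < x"
      using assms(1) u(1) that by (auto simp: chains_around_pair_def)
    then show ?thesis using u(2) by (meson less_imp_le less_trans)
  qed
  then show ?thesis using u(1) by blast
qed

lemma pair_below_chain_upper:
  assumes "chains_around_pair T L x y V"
  shows "pair_below_chain (\<le>) x y V"
  using assms unfolding chains_around_pair_def pair_below_chain_def
  by (auto simp: less_le_not_le)

lemma pair_below_chain_lower:
  assumes "chains_around_pair T L x y V"
  shows "pair_below_chain (\<lambda>a b. b \<le> a) x y L"
  using assms unfolding chains_around_pair_def pair_below_chain_def
  by (auto simp: less_le_not_le)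

lemma chain_below_pair_lower:
  assumes "chains_around_pair T L x y V" "T \<subseteq> S"
    and mono: "\<And>g h. g \<in> S \<Longrightarrow> h \<in> S \<Longrightarrow> g < h \<Longrightarrow> proj_le (P g) (P h) \<and> P g \<noteq> P h"
    and refl: "\<And>g. g \<in> S \<Longrightarrow> proj_le (P g) (P g)"
  shows "chain_below_pair P L x y"
proof -
  have S: "x \<in> S" "y \<in> S" "L \<subseteq> S" and xy: "\<not> x \<le> y"
    and less: "\<And>l. l \<in> L \<Longrightarrow> l < x \<and> l < y"
    and total: "\<And>a b. a \<in> L \<Longrightarrow> b \<in> L \<Longrightarrow> a = b \<or> a < b \<or> b < a"
    using assms(1,2) by (auto simp: chains_around_pair_def less_le)
  have "P a \<noteq> P b" if "a \<in> L" "b \<in> L" "a \<noteq> b" for a b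
    using total[OF that(1,2)] mono[of a b] mono[of b a] that subsetD[OF S(3)] by metis
  moreover have "proj_le (P a) (P b) \<or> proj_le (P b) (P a)" if "a \<in> L" "b \<in> L" for a b
    using total[OF that(1,2)] mono[of a b] mono[of b a] that subsetD[OF S(3)] refl by metis
  ultimately show ?thesis
    unfolding chain_below_pair_def inj_on_def using xy less mono S by blast
qed

lemma chain_below_pair_upper:
  assumes "chains_around_pair T L x y V" "T \<subseteq> S"
    and mono: "\<And>g h. g \<in> S \<Longrightarrow> h \<in> S \<Longrightarrow> g < h \<Longrightarrow> proj_le (Q h) (Q g) \<and> Q g \<noteq> Q h"
    and refl: "\<And>g. g \<in> S \<Longrightarrow> proj_le (Q g) (Q g)"
  shows "chain_below_pair Q V x y"
proof -
  have S: "x \<in> S" "y \<in> S" "V \<subseteq> S" and xy: "\<not> x \<le> y"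
    and less: "\<And>v. v \<in> V \<Longrightarrow> x < v \<and> y < v"
    and total: "\<And>a b. a \<in> V \<Longrightarrow> b \<in> V \<Longrightarrow> a = b \<or> a < b \<or> b < a"
    using assms(1,2) by (auto simp: chains_around_pair_def less_le)
  have "Q a \<noteq> Q b" if "a \<in> V" "b \<in> V" "a \<noteq> b" for a b
    using total[OF that(1,2)] mono[of a b] mono[of b a] that subsetD[OF S(3)] by metis
  moreover have "proj_le (Q a) (Q b) \<or> proj_le (Q b) (Q a)" if "a \<in> V" "b \<in> V" for a b
    using total[OF that(1,2)] mono[of a b] mono[of b a] that subsetD[OF S(3)] refl by metis
  ultimately show ?thesis
    unfolding chain_below_pair_def inj_on_def using xy less mono S by blast
qed

text \<open>
  A singleton below its pair makes its part have a least element, and one above makes it have a greatest.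
  Such elements in different parts exclude each other directly; if they are in the same part, the other part
  is for this reason a bare pair, and then they exclude each other as well.
\<close>

lemma one_sided:
  fixes S :: "'a::order set" and P :: "'a \<Rightarrow> 'h::chilbert_space \<Rightarrow> 'h"
  assumes ip: "irreducible_projections S P \<alpha> \<gamma>"
    and mono: "\<And>g h. g \<in> S \<Longrightarrow> h \<in> S \<Longrightarrow> g < h \<Longrightarrow> proj_le (P g) (P h) \<and> P g \<noteq> P h"
    and S: "S = T \<union> U" "T \<inter> U = {}"
    and T: "chains_around_pair T L x y V" and U: "chains_around_pair U L' x' y' V'"
  shows "L = {} \<or> V = {} \<and> V' = {}"
proof (rule ccontr)
  interpret irreducible_projections S P \<alpha> \<gamma> by (fact ip)
  have le: "proj_le (P g) (P h)" if "g \<in> S" "h \<in> S" "g \<le> h" for g h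
    using mono[of g h] proj_le_refl[OF proj] that by (cases "g = h") auto
  have sub: "L \<subseteq> T" "V \<subseteq> T" "L' \<subseteq> U" "V' \<subseteq> U" "x \<in> T"
    using T U by (auto simp: chains_around_pair_def)
  then have fin: "finite L" "finite V" "finite L'" "finite V'"
    using S(1) finite_S by (auto intro: finite_subset)
  assume "\<not> (L = {} \<or> V = {} \<and> V' = {})"
  then have "L \<noteq> {}" and V: "V \<noteq> {} \<or> V' \<noteq> {}" by auto
  obtain l where l: "l \<in> L" "\<And>g. g \<in> T \<Longrightarrow> l \<le> g"
    using chains_around_pair_least[OF T fin(1) \<open>L \<noteq> {}\<close>] by blast
  have lT: "l \<in> T" "l \<in> S" using l(1) sub(1) S(1) by auto
  have "V' = {}"
  proof (rule ccontr)
    assume "V' \<noteq> {}"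
    then obtain u where u: "u \<in> V'" "\<And>g. g \<in> U \<Longrightarrow> g \<le> u"
      using chains_around_pair_greatest[OF U fin(4)] by blast
    have uU: "u \<in> U" "u \<in> S" using u(1) sub(4) S(1) by auto
    show False
      by (rule no_least_and_greatest_across[OF S lT(1) _ uU(1)])
         (use le l(2) u(2) lT uU S(1) in auto)
  qed
  then have "V \<noteq> {}" using V by simp
  then obtain u where u: "u \<in> V" "\<And>g. g \<in> T \<Longrightarrow> g \<le> u"
    using chains_around_pair_greatest[OF T fin(2)] by blast
  have uT: "u \<in> T" "u \<in> S" using u(1) sub(2) S(1) by auto
  have "L' = {}"
  proof (rule ccontr)
    assume "L' \<noteq> {}"
    then obtain l' where l': "l' \<in> L'" "\<And>g. g \<in> U \<Longrightarrow> l' \<le> g"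
      using chains_around_pair_least[OF U fin(3)] by blast
    have lU: "l' \<in> U" "l' \<in> S" using l'(1) sub(3) S(1) by auto
    have S': "S = U \<union> T" "U \<inter> T = {}" using S by auto
    show False
      by (rule no_least_and_greatest_across[OF S' lU(1) _ uT(1)])
         (use le l'(2) u(2) lU uT S(1) in auto)
  qed
  then have U': "U = {x', y'}" "x' \<noteq> y'"
    using U \<open>V' = {}\<close> by (auto simp: chains_around_pair_def)
  have "l < x" "x < u" using T l(1) u(1) by (auto simp: chains_around_pair_def)
  then have "P l \<noteq> P u" using mono[OF lT(2) uT(2)] by auto
  then show False
    using no_least_and_greatest_beside_pair[of T x' y' l u] S U' le l(2) u(2) lT uT by auto
qed

theorem theorem3:
  fixes S S1 S2 :: "'a::order set"
  assumes "finite S"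
    and "essential_poset TYPE('h::chilbert_space) S"
    and "S = S1 \<union> S2" and "S1 \<inter> S2 = {}"
    and "unitarily_one_parameter S1" and "unitarily_one_parameter S2"
  shows "isomorphic_to_generated_poset S 4 {} \<or>
         isomorphic_to_generated_poset S 5 {(1, 5), (2, 5)} \<or>
         isomorphic_to_generated_poset S 5 {(5, 1), (5, 2)} \<or>
         isomorphic_to_generated_poset S 6 {(1, 5), (2, 5), (5, 6)} \<or>
         isomorphic_to_generated_poset S 6 {(6, 5), (5, 1), (5, 2)} \<or>
         isomorphic_to_generated_poset S 6 {(1, 5), (2, 5), (3, 6), (4, 6)} \<or>
         isomorphic_to_generated_poset S 6 {(5, 1), (5, 2), (6, 3), (6, 4)}"
proof -
  obtain P :: "'a \<Rightarrow> 'h \<Rightarrow> 'h" where P: "irreducible_representation S P" "essential_representation S P"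
    using assms(2) by (auto simp: essential_poset_def)
  obtain \<alpha> where \<alpha>: "orthoscalar_with S \<alpha> P"
    using P(2) by (auto simp: essential_representation_def orthoscalar_def)
  have "irreducible_projections S P \<alpha> 1"
  proof
    show "orthogonal_projection (P g)" if "g \<in> S" for g
      using \<alpha> that by (simp add: orthoscalar_with_def poset_representation_def)
    show "M = {0} \<or> M = UNIV"
      if "csubspace M" "closed M" "\<And>g. g \<in> S \<Longrightarrow> P g ` M \<subseteq> M" for M
      using P(1) that by (simp add: irreducible_representation_def)
    show "P g \<noteq> (\<lambda>x. 0)" "P g \<noteq> id" if "g \<in> S" for g
      using P(2) that by (simp_all add: essential_representation_def)
    show "0 < \<alpha> g" if "g \<in> S" for g
      using \<alpha> that by (simp add: orthoscalar_with_def poset_character_def)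
    show "(\<Sum>g\<in>S. \<alpha> g *\<^sub>R P g x) = 1 *\<^sub>R x" for x
      using \<alpha> by (simp add: orthoscalar_with_def)
  qed (fact assms(1))
  then interpret irreducible_projections S P \<alpha> 1 .
  interpret dual: irreducible_projections S "\<lambda>g x. x - P g x" \<alpha> "sum \<alpha> S - 1" by (rule complements)
  have mono: "proj_le (P g) (P h) \<and> P g \<noteq> P h" if "g \<in> S" "h \<in> S" "g < h" for g h
    using \<alpha> P(2) that
    by (auto simp: orthoscalar_with_def poset_representation_def essential_representation_def proj_le_def)
  \<comment> \<open>The complements form a family of the same kind for the converse order.\<close>
  have dual_mono: "proj_le (\<lambda>x. x - P h x) (\<lambda>x. x - P g x) \<and> (\<lambda>x. x - P g x) \<noteq> (\<lambda>x. x - P h x)"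
    if "g \<in> S" "h \<in> S" "g < h" for g h
    using mono[OF that] proj_le_complement[OF proj[OF that(1)] proj[OF that(2)]]
    by (auto simp: fun_eq_iff)
  obtain L x y V where 1: "chains_around_pair S1 L x y V"
    using unitarily_one_parameter_chains[OF assms(5)] by blast
  obtain L' x' y' V' where 2: "chains_around_pair S2 L' x' y' V'"
    using unitarily_one_parameter_chains[OF assms(6)] by blast
  have sub: "S1 \<subseteq> S" "S2 \<subseteq> S" using assms(3) by auto
  have S1: "S1 = L \<union> {x, y} \<union> V" and S2: "S2 = L' \<union> {x', y'} \<union> V'"
    using 1 2 by (auto simp: chains_around_pair_def)
  have fin: "finite L" "finite V" "finite L'" "finite V'"
    using assms(1,3) by (auto simp: S1 S2)
  have "(V = {} \<and> V' = {}) \<or> (L = {} \<and> L' = {})"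
    using one_sided[OF irreducible_projections_axioms mono assms(3,4) 1 2]
      one_sided[OF irreducible_projections_axioms mono _ _ 2 1] assms(3,4)
    by (auto simp: Un_commute Int_commute)
  then show ?thesis
  proof
    assume V: "V = {} \<and> V' = {}"
    have S1': "S1 = L \<union> {x, y}" and S2': "S2 = L' \<union> {x', y'}" using V S1 S2 by auto
    have "chain_below_pair P L x y" "chain_below_pair P L' x' y'"
      using chain_below_pair_lower[OF 1 sub(1) mono] chain_below_pair_lower[OF 2 sub(2) mono]
        proj_le_refl[OF proj] by auto
    then have pairs: "two_chain_pairs L x y L' x' y'"
      unfolding two_chain_pairs_def S1'[symmetric] S2'[symmetric] using assms(3,4) by blast
    have "\<not> a < b \<and> \<not> b < a" if "a \<in> S1" "b \<in> S2" for a b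
      using no_relation_across[OF pairs, of a b]
        no_relation_across[OF iffD1[OF two_chain_pairs_commute(1) pairs], of b a]
        mono[of a b] mono[of b a] subsetD[OF sub(1) that(1)] subsetD[OF sub(2) that(2)] that
      unfolding S1'[symmetric] S2'[symmetric] by blast
    then have cross: "\<not> a \<le> b \<and> \<not> b \<le> a" if "a \<in> S1" "b \<in> S2" for a b
      using assms(4) that by (metis disjoint_iff order_le_less)
    have "relation_isomorphic (\<lambda>a b. b \<le> a) S 4 {} \<or>
         relation_isomorphic (\<lambda>a b. b \<le> a) S 5 {(1, 5), (2, 5)} \<or>
         relation_isomorphic (\<lambda>a b. b \<le> a) S 6 {(1, 5), (2, 5), (5, 6)} \<or>
         relation_isomorphic (\<lambda>a b. b \<le> a) S 6 {(1, 5), (2, 5), (3, 6), (4, 6)}"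
    proof (rule classify)
      show "card L + card L' \<le> 2" using pairs by (rule card_chains_le_2)
      show "pair_below_chain (\<lambda>a b. b \<le> a) x y L" using 1 by (rule pair_below_chain_lower)
      show "pair_below_chain (\<lambda>a b. b \<le> a) x' y' L'" using 2 by (rule pair_below_chain_lower)
      show "\<not> b \<le> a \<and> \<not> a \<le> b" if "a \<in> {x, y} \<union> L" "b \<in> {x', y'} \<union> L'" for a b
        using cross[of a b] that by (auto simp: S1 S2)
      show "S = {x, y} \<union> L \<union> ({x', y'} \<union> L')" using V by (auto simp: assms(3) S1 S2)
    qed (use fin in auto)
    moreover have "{(1, 5), (2, 5)}\<inverse> = {(5 :: nat, 1 :: nat), (5, 2)}"
      "{(1, 5), (2, 5), (5, 6)}\<inverse> = {(6 :: nat, 5 :: nat), (5, 1), (5, 2)}"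
      "{(1, 5), (2, 5), (3, 6), (4, 6)}\<inverse> = {(5 :: nat, 1 :: nat), (5, 2), (6, 3), (6, 4)}"
      by auto
    ultimately show ?thesis
      using relation_isomorphic_ge[of S] by (metis converse_empty)
  next
    assume L: "L = {} \<and> L' = {}"
    have S1': "S1 = V \<union> {x, y}" and S2': "S2 = V' \<union> {x', y'}" using L S1 S2 by auto
    have "chain_below_pair (\<lambda>g x. x - P g x) V x y" "chain_below_pair (\<lambda>g x. x - P g x) V' x' y'"
      using chain_below_pair_upper[OF 1 sub(1) dual_mono] chain_below_pair_upper[OF 2 sub(2) dual_mono]
        proj_le_refl[OF dual.proj] by auto
    then have pairs: "dual.two_chain_pairs V x y V' x' y'"
      unfolding dual.two_chain_pairs_def S1'[symmetric] S2'[symmetric] using assms(3,4) by blast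
    have "\<not> a < b \<and> \<not> b < a" if "a \<in> S1" "b \<in> S2" for a b
      using dual.no_relation_across[OF pairs, of a b]
        dual.no_relation_across[OF iffD1[OF dual.two_chain_pairs_commute(1) pairs], of b a]
        dual_mono[of a b] dual_mono[of b a] subsetD[OF sub(1) that(1)] subsetD[OF sub(2) that(2)] that
      unfolding S1'[symmetric] S2'[symmetric] by metis
    then have cross: "\<not> a \<le> b \<and> \<not> b \<le> a" if "a \<in> S1" "b \<in> S2" for a b
      using assms(4) that by (metis disjoint_iff order_le_less)
    have "relation_isomorphic (\<le>) S 4 {} \<or>
         relation_isomorphic (\<le>) S 5 {(1, 5), (2, 5)} \<or>
         relation_isomorphic (\<le>) S 6 {(1, 5), (2, 5), (5, 6)} \<or>
         relation_isomorphic (\<le>) S 6 {(1, 5), (2, 5), (3, 6), (4, 6)}"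
    proof (rule classify)
      show "card V + card V' \<le> 2" using pairs by (rule dual.card_chains_le_2)
      show "pair_below_chain (\<le>) x y V" using 1 by (rule pair_below_chain_upper)
      show "pair_below_chain (\<le>) x' y' V'" using 2 by (rule pair_below_chain_upper)
      show "\<not> a \<le> b \<and> \<not> b \<le> a" if "a \<in> {x, y} \<union> V" "b \<in> {x', y'} \<union> V'" for a b
        using cross[of a b] that by (auto simp: S1 S2)
      show "S = {x, y} \<union> V \<union> ({x', y'} \<union> V')" using L by (auto simp: assms(3) S1 S2)
    qed (use fin in auto)
    then show ?thesis
      by (elim disjE) (auto dest!: relation_isomorphic_le)
  qed
qed

end
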